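(* Let $X$ be an Asplund space, let $A,B\subset X$ be nonempty, and suppose that $A-B$ is closed. If $A\cap B=\emptyset$, then for any $\varepsilon>0$ there exist points $a\in A$ and $b\in B$ satisfying $$\|a-b\|<d(A,B)+\varepsilon$$ and an $a^*\in X^*$ satisfying $$\|a^*\|=1,\quad a^*\in N_A(a)\quad\text{and}\quad-a^*\in N_B(b).$$
   Context: A Banach space is Asplund if every continuous convex function defined on an open convex set $D$ is Fréchet differentiable at each point of some dense subset of $D$; equivalently, the dual of each of its separable subspaces is separable. $X^*$ is the topological dual of $X$ with the dual norm. $A-B=\{a-b\mid a\in A,\ b\in B\}$ and $d(A,B)=\inf_{a\in A,\,b\in B}\|a-b\|$. For $A\subset X$ and $a\in A$, the Fréchet normal cone to $A$ at $a$ is $$N_A(a)=\Big\{x^*\in X^*\;\Big|\;\limsup_{x\to a,\;x\in A\setminus\{a\}}\frac{\langle x^*,x-a\rangle}{\|x-a\|}\le0\Big\},$$ i.e. $x^*\in N_A(a)$ iff for every $\eta>0$ there is $\delta>0$ with $\langle x^*,x-a\rangle\le\eta\|x-a\|$ for all $x\in A$ with $\|x-a\|<\delta$. *)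

theory Defs
  imports "HOL-Analysis.Analysis"
begin

text \<open>Differentiability in the library's sense (\<^const>\<open>has_derivative\<close>) is Frechet differentiability.\<close>

definition asplund_space :: "'a::banach itself \<Rightarrow> bool" where
  "asplund_space _ \<longleftrightarrow>
     (\<forall>(D :: 'a set) (f :: 'a \<Rightarrow> real).
        open D \<and> convex D \<and> continuous_on D f \<and> convex_on D f \<longrightarrow>
        (\<exists>S \<subseteq> D. D \<subseteq> closure S \<and> (\<forall>x\<in>S. f differentiable (at x))))"

definition diff_set :: "'a::ab_group_add set \<Rightarrow> 'a set \<Rightarrow> 'a set" where
  "diff_set A B = {a - b | a b. a \<in> A \<and> b \<in> B}"

text \<open>The filter \<^term>\<open>at a within A\<close> already excludes the point \<open>a\<close>. If \<open>a\<close> is isolated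
  in \<open>A\<close>, the upper limit is \<open>-\<infinity>\<close> and the cone is the whole dual.\<close>

definition frechet_normal_cone :: "'a::real_normed_vector set \<Rightarrow> 'a \<Rightarrow> ('a \<Rightarrow>\<^sub>L real) set" where
  "frechet_normal_cone A a =
     {x'. Limsup (at a within A) (\<lambda>x. ereal (blinfun_apply x' (x - a) / norm (x - a))) \<le> 0}"

lemma frechet_normal_cone_iff:
  "x' \<in> frechet_normal_cone A a \<longleftrightarrow>
     (\<forall>\<eta>>0. \<exists>\<delta>>0. \<forall>x\<in>A. norm (x - a) < \<delta> \<longrightarrow> blinfun_apply x' (x - a) \<le> \<eta> * norm (x - a))"
  (is "?L \<longleftrightarrow> ?R")
proof -
  let ?q = "\<lambda>x. blinfun_apply x' (x - a) / norm (x - a)"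
  have "?L \<longleftrightarrow> (\<forall>y>0. eventually (\<lambda>x. ereal (?q x) < y) (at a within A))"
    by (simp add: frechet_normal_cone_def Limsup_le_iff)
  also have "\<dots> \<longleftrightarrow> (\<forall>\<eta>>0. eventually (\<lambda>x. ?q x \<le> \<eta>) (at a within A))"
  proof (intro iffI allI impI)
    fix \<eta> :: real
    assume *: "\<forall>y>0. eventually (\<lambda>x. ereal (?q x) < y) (at a within A)" and "\<eta> > 0"
    then have "eventually (\<lambda>x. ereal (?q x) < ereal \<eta>) (at a within A)"
      using *[rule_format, of "ereal \<eta>"] by simp
    then show "eventually (\<lambda>x. ?q x \<le> \<eta>) (at a within A)"
      by eventually_elim simp
  next
    fix y :: ereal
    assume *: "\<forall>\<eta>>0. eventually (\<lambda>x. ?q x \<le> \<eta>) (at a within A)" and "0 < y"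
    then obtain z :: real where z: "0 < z" "ereal z < y"
      using ereal_dense2[of 0 y] by auto
    with * have "eventually (\<lambda>x. ?q x \<le> z) (at a within A)"
      by simp
    then show "eventually (\<lambda>x. ereal (?q x) < y) (at a within A)"
      by eventually_elim (use z in \<open>meson ereal_less_eq(3) order_le_less_trans\<close>)
  qed
  also have "\<dots> \<longleftrightarrow> ?R"
  proof -
    have "(?q x \<le> \<eta>) = (blinfun_apply x' (x - a) \<le> \<eta> * norm (x - a))" if "x \<noteq> a" for x \<eta>
      using that by (simp add: divide_le_eq)
    moreover have "blinfun_apply x' (x - a) \<le> \<eta> * norm (x - a)" if "x = a" for x \<eta>
      using that by (simp add: blinfun.zero_right)
    ultimately show ?thesis
      unfolding eventually_at dist_norm by metis
  qed
  finally show ?thesis .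
qed

end

theory Submission
  imports Defs
begin

text \<open>The sets \<open>A\<close> and \<open>B\<close> enter only through the closed set \<open>C = A - B\<close>, which does not contain
\<open>0\<close>. Near \<open>a - b\<close> the set \<open>C\<close> contains a translate of \<open>A\<close> near \<open>a\<close> and a translate of \<open>- B\<close>
near \<open>- b\<close>, so a Frechet normal to \<open>C\<close> at \<open>a - b\<close> is normal to \<open>A\<close> at \<open>a\<close>, and its negative is
normal to \<open>B\<close> at \<open>b\<close>. What has to be shown is that \<open>C\<close> has a nonzero Frechet normal at a point
whose norm almost equals the distance from \<open>0\<close> to \<open>C\<close> (\<open>closed_set_frechet_normal\<close>).

If the norm were Frechet smooth away from \<open>0\<close>, this would follow from a smooth variational principle:
the norm plus a small series of smooth perturbations attains its minimum over \<open>C\<close>, and minus the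
gradient of this function at the minimum point is normal to \<open>C\<close>. An Asplund space need not have an
equivalent smooth norm, but a separable space with separable dual does. The proof therefore works
inside a closed separable subspace \<open>Y\<close>.

\<^item> Separable reduction (\<open>separable_reduction\<close>): \<open>Y\<close> can be chosen so rich that a
functional that does not vanish on \<open>Y\<close> and is normal to \<open>C \<inter> Y\<close> at a point of this set guarantees a
nonzero normal to \<open>C\<close> at the same point.

\<^item> Separability of the dual (\<open>dual_ball_separable\<close>): otherwise the dual ball contains an
uncountable family of functionals that are uniformly separated on \<open>Y\<close>, and this family can be
thinned out so that all its nonempty slices by points of \<open>Y\<close> are uncountable. Frechet
differentiability of a suitable sublinear functional on the whole space produces a slice that is too
small for that.

\<^item> Smoothing (\<open>smooth_norm_approximation\<close>): the norm is the support function of the dual ball.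
Subtracting from each functional a small strictly convex penalty, built from a sequence that is dense
in the dual, makes near-maximizers converge in norm, and this is Frechet smoothness. The result is
uniformly close to the norm, which is all that the variational principle needs.

Functionals are treated as plain functions, so that the weak-star topology on the dual ball is
the product topology, and the norm of the dual of \<open>Y\<close> becomes a bound on the values at points of
\<open>Y\<close>.\<close>

section \<open>Sublinear functionals and the theorem of Hahn and Banach\<close>

definition sublinear :: "('a::real_vector \<Rightarrow> real) \<Rightarrow> bool" where
  "sublinear p \<longleftrightarrow> (\<forall>x y. p (x + y) \<le> p x + p y) \<and> (\<forall>t\<ge>0. \<forall>x. p (t *\<^sub>R x) = t * p x)"

lemma sublinear_add: "sublinear p \<Longrightarrow> p (x + y) \<le> p x + p y"
  and sublinear_scale: "sublinear p \<Longrightarrow> t \<ge> 0 \<Longrightarrow> p (t *\<^sub>R x) = t * p x"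
  by (auto simp: sublinear_def)

lemma sublinear_zero: "sublinear p \<Longrightarrow> p 0 = 0"
  using sublinear_scale[of p 0 0] by simp

lemma sublinear_neg: "sublinear p \<Longrightarrow> - p (- x) \<le> p x"
  using sublinear_add[of p x "- x"] by (simp add: sublinear_zero)

lemma sublinear_norm: "sublinear (norm :: 'a::real_normed_vector \<Rightarrow> real)"
  by (simp add: sublinear_def norm_triangle_ineq)

lemma sublinear_odd_imp_linear:
  assumes p: "sublinear p" and odd: "\<And>x. p x \<le> - p (- x)"
  shows "linear p"
proof -
  have o: "p (- x) = - p x" for x
    using odd[of x] sublinear_neg[OF p, of x] by simp
  show ?thesis
  proof (rule linearI)
    fix x y
    have "p x \<le> p (x + y) + p (- y)"
      using sublinear_add[OF p, of "x + y" "- y"] by simp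
    then show "p (x + y) = p x + p y"
      using sublinear_add[OF p, of x y] o[of y] by simp
  next
    fix c :: real and x
    show "p (c *\<^sub>R x) = c *\<^sub>R p x"
    proof (cases "c \<ge> 0")
      case False
      then have "p ((- c) *\<^sub>R (- x)) = (- c) * p (- x)"
        by (intro sublinear_scale[OF p]) auto
      then show ?thesis using o by simp
    qed (simp add: sublinear_scale[OF p])
  qed
qed

text \<open>The support function of the part of \<open>{f. f \<le> p}\<close> that satisfies \<open>f x \<le> c\<close>.\<close>

text \<open>The support function of \<open>{f. f \<le> p \<and> f x \<le> c}\<close>, written without reference to functionals. Minimality of a
sublinear functional is exploited by cutting it down in this way.\<close>
definition halfspace_cut :: "('a::real_vector \<Rightarrow> real) \<Rightarrow> 'a \<Rightarrow> real \<Rightarrow> 'a \<Rightarrow> real" where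
  "halfspace_cut p x c z = (INF t\<in>{0..}. p (z - t *\<^sub>R x) + t * c)"

context
  fixes p :: "'a::real_vector \<Rightarrow> real" and x :: 'a and c :: real
  assumes p: "sublinear p" and c: "- p (- x) \<le> c"
begin

lemma halfspace_cut_bdd: "bdd_below ((\<lambda>t. p (z - t *\<^sub>R x) + t * c) ` {0..})"
proof (rule bdd_belowI2)
  fix t :: real assume "t \<in> {0..}"
  then have t: "t \<ge> 0" by simp
  have "p (t *\<^sub>R (- x)) \<le> p (z - t *\<^sub>R x) + p (- z)"
    using sublinear_add[OF p, of "z - t *\<^sub>R x" "- z"] by simp
  moreover have "p (t *\<^sub>R (- x)) = t * p (- x)"
    by (rule sublinear_scale[OF p t])
  moreover have "0 \<le> t * (p (- x) + c)"
    using t c by simp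
  ultimately show "- p (- z) \<le> p (z - t *\<^sub>R x) + t * c"
    by (simp add: algebra_simps)
qed

lemma halfspace_cut_le: "t \<ge> 0 \<Longrightarrow> halfspace_cut p x c z \<le> p (z - t *\<^sub>R x) + t * c"
  unfolding halfspace_cut_def by (rule cINF_lower[OF halfspace_cut_bdd]) simp

lemma halfspace_cut_ge: "(\<And>t. t \<ge> 0 \<Longrightarrow> m \<le> p (z - t *\<^sub>R x) + t * c) \<Longrightarrow> m \<le> halfspace_cut p x c z"
  unfolding halfspace_cut_def by (rule cINF_greatest) auto

lemma halfspace_cut_le_self: "halfspace_cut p x c \<le> p"
  using halfspace_cut_le[of 0] by (simp add: le_fun_def)

lemma halfspace_cut_at: "halfspace_cut p x c x \<le> c"
  using halfspace_cut_le[of 1 x] by (simp add: sublinear_zero[OF p])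

lemma sublinear_halfspace_cut: "sublinear (halfspace_cut p x c)"
  unfolding sublinear_def
proof (intro conjI allI impI)
  fix y z
  have "halfspace_cut p x c (y + z) - halfspace_cut p x c z \<le> p (y - s *\<^sub>R x) + s * c" if s: "s \<ge> 0" for s
  proof -
    have "halfspace_cut p x c (y + z) - (p (y - s *\<^sub>R x) + s * c) \<le> p (z - t *\<^sub>R x) + t * c"
      if t: "t \<ge> 0" for t
    proof -
      have "halfspace_cut p x c (y + z) \<le> p (y + z - (s + t) *\<^sub>R x) + (s + t) * c"
        using s t by (intro halfspace_cut_le) simp
      also have "y + z - (s + t) *\<^sub>R x = (y - s *\<^sub>R x) + (z - t *\<^sub>R x)"
        by (simp add: algebra_simps)
      also have "p \<dots> \<le> p (y - s *\<^sub>R x) + p (z - t *\<^sub>R x)"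
        by (rule sublinear_add[OF p])
      finally show ?thesis by (simp add: algebra_simps)
    qed
    from halfspace_cut_ge[OF this] show ?thesis by simp
  qed
  from halfspace_cut_ge[OF this] show "halfspace_cut p x c (y + z) \<le> halfspace_cut p x c y + halfspace_cut p x c z" by simp
next
  have *: "halfspace_cut p x c (r *\<^sub>R z) \<le> r * halfspace_cut p x c z" if r: "r > 0" for r z
  proof -
    have "halfspace_cut p x c (r *\<^sub>R z) / r \<le> p (z - t *\<^sub>R x) + t * c" if t: "t \<ge> 0" for t
    proof -
      have "halfspace_cut p x c (r *\<^sub>R z) \<le> p (r *\<^sub>R z - (r * t) *\<^sub>R x) + (r * t) * c"
        using r t by (intro halfspace_cut_le) simp
      also have "r *\<^sub>R z - (r * t) *\<^sub>R x = r *\<^sub>R (z - t *\<^sub>R x)"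
        by (simp add: algebra_simps)
      also have "p \<dots> = r * p (z - t *\<^sub>R x)"
        using r by (simp add: sublinear_scale[OF p])
      finally show ?thesis using r by (simp add: field_simps)
    qed
    from halfspace_cut_ge[OF this] show ?thesis using r by (simp add: field_simps)
  qed
  fix r :: real and z assume "r \<ge> 0"
  show "halfspace_cut p x c (r *\<^sub>R z) = r * halfspace_cut p x c z"
  proof (cases "r = 0")
    case True
    have "0 \<le> halfspace_cut p x c 0"
    proof (rule halfspace_cut_ge)
      fix t :: real assume t: "t \<ge> 0"
      have "p (0 - t *\<^sub>R x) = t * p (- x)"
        using sublinear_scale[OF p t, of "- x"] by simp
      moreover have "0 \<le> t * (p (- x) + c)" using t c by simp
      ultimately show "0 \<le> p (0 - t *\<^sub>R x) + t * c" by (simp add: algebra_simps)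
    qed
    moreover have "halfspace_cut p x c 0 \<le> 0"
      using halfspace_cut_le[of 0 0] by (simp add: sublinear_zero[OF p])
    ultimately show ?thesis using True by simp
  next
    case False
    with \<open>r \<ge> 0\<close> have r: "r > 0" by simp
    have "halfspace_cut p x c (inverse r *\<^sub>R (r *\<^sub>R z)) \<le> inverse r * halfspace_cut p x c (r *\<^sub>R z)"
      using r by (intro *) simp
    then show ?thesis using *[OF r, of z] r by (simp add: field_simps)
  qed
qed

end

text \<open>The lower bound \<open>g\<close> on \<open>Y\<close> is a parameter because two choices are needed: a linear \<open>g\<close> yields
the theorem of Hahn and Banach, and a supremum of functionals yields small slices.\<close>
lemma minimal_sublinear:
  fixes s g :: "'a::real_vector \<Rightarrow> real"
  assumes s: "sublinear s" and g: "\<And>y. y \<in> Y \<Longrightarrow> g y \<le> s y"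
  obtains p where "sublinear p" "p \<le> s" "\<And>y. y \<in> Y \<Longrightarrow> g y \<le> p y"
    "\<And>q. sublinear q \<Longrightarrow> q \<le> p \<Longrightarrow> (\<And>y. y \<in> Y \<Longrightarrow> g y \<le> q y) \<Longrightarrow> q = p"
proof -
  define A where "A = {q. sublinear q \<and> q \<le> s \<and> (\<forall>y\<in>Y. g y \<le> q y)}"
  have sA: "s \<in> A" using s g by (simp add: A_def)
  have "\<exists>m\<in>A. \<forall>a\<in>A. a \<le> m \<longrightarrow> a = m"
  proof (rule predicate_Zorn)
    show "partial_order_on A (relation_of (\<lambda>x y. y \<le> x) A)"
      by (rule partial_order_on_relation_ofI) auto
  next
    fix C assume "C \<in> Chains (relation_of (\<lambda>x y. y \<le> x) A)"
    then have CA: "C \<subseteq> A" and chain: "\<And>a b. a \<in> C \<Longrightarrow> b \<in> C \<Longrightarrow> a \<le> b \<or> b \<le> a"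
      by (auto simp: Chains_def relation_of_def)
    show "\<exists>u\<in>A. \<forall>a\<in>C. u \<le> a"
    proof (cases "C = {}")
      case True
      then show ?thesis using sA by auto
    next
      case False
      then obtain q0 where q0: "q0 \<in> C" by blast
      have sub: "sublinear q" and le: "q x \<le> s x" and gq: "y \<in> Y \<Longrightarrow> g y \<le> q y" if "q \<in> C" for q x y
        using that CA by (auto simp: A_def le_fun_def)
      define u where "u x = (INF q\<in>C. q x)" for x
      have low: "- s (- x) \<le> q x" if "q \<in> C" for q x
        using sublinear_neg[OF sub[OF that], of x] le[OF that, of "- x"] by linarith
      have bdd: "bdd_below ((\<lambda>q. q x) ` C)" for x
        by (rule bdd_belowI2[where m = "- s (- x)"]) (rule low)
      have u_le: "u x \<le> q x" if "q \<in> C" for q x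
        unfolding u_def by (rule cINF_lower[OF bdd that])
      have u_ge: "m \<le> u x" if "\<And>q. q \<in> C \<Longrightarrow> m \<le> q x" for m x
        unfolding u_def using False that by (rule cINF_greatest)
      have "sublinear u"
        unfolding sublinear_def
      proof (intro conjI allI impI)
        fix x y
        have *: "u (x + y) - u y \<le> q x" if q: "q \<in> C" for q
        proof -
          have *: "u (x + y) - q x \<le> r y" if r: "r \<in> C" for r
          proof (cases "q \<le> r")
            case True
            then have "q y \<le> r y" by (simp add: le_fun_def)
            then show ?thesis
              using u_le[OF q, of "x + y"] sublinear_add[OF sub[OF q], of x y] by linarith
          next
            case False
            then have "r x \<le> q x" using chain[OF q r] by (auto simp: le_fun_def)
            then show ?thesis
              using u_le[OF r, of "x + y"] sublinear_add[OF sub[OF r], of x y] by linarith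
          qed
          have "u (x + y) - q x \<le> u y" by (rule u_ge, rule *)
          then show ?thesis by simp
        qed
        have "u (x + y) - u y \<le> u x" by (rule u_ge, rule *)
        then show "u (x + y) \<le> u x + u y" by simp
      next
        fix t :: real and x assume t: "t \<ge> 0"
        have sc: "q (t *\<^sub>R x) = t * q x" if "q \<in> C" for q
          by (rule sublinear_scale[OF sub[OF that] t])
        show "u (t *\<^sub>R x) = t * u x"
        proof (cases "t = 0")
          case True
          have "u 0 \<le> 0" using u_le[OF q0, of 0] sublinear_zero[OF sub[OF q0]] by simp
          moreover have "0 \<le> u 0" by (rule u_ge) (simp add: sublinear_zero[OF sub])
          ultimately show ?thesis using True by simp
        next
          case False
          with t have t: "t > 0" by simp
          have "t * u x \<le> u (t *\<^sub>R x)"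
            by (rule u_ge) (simp add: sc u_le t)
          moreover have "u (t *\<^sub>R x) / t \<le> u x"
          proof (rule u_ge)
            fix q assume q: "q \<in> C"
            show "u (t *\<^sub>R x) / t \<le> q x"
              using u_le[OF q, of "t *\<^sub>R x"] sc[OF q] t by (simp add: field_simps)
          qed
          ultimately show ?thesis using t by (simp add: field_simps)
        qed
      qed
      moreover have "u \<le> s"
        using u_le[OF q0] le[OF q0] by (auto simp: le_fun_def intro: order_trans)
      moreover have "\<forall>y\<in>Y. g y \<le> u y"
        by (auto intro!: u_ge gq)
      ultimately have "u \<in> A" by (simp add: A_def)
      then show ?thesis using u_le by (auto simp: le_fun_def)
    qed
  qed
  then obtain m where "m \<in> A" "\<forall>a\<in>A. a \<le> m \<longrightarrow> a = m" by blast
  then show ?thesis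
    by (intro that[of m]) (auto simp: A_def intro: order_trans)
qed

text \<open>A minimal sublinear functional that dominates \<open>e\<close> on \<open>Y\<close> admits no proper cut that still
dominates \<open>e\<close>. This first forces equality with \<open>e\<close> on \<open>Y\<close> and then oddness, hence linearity.\<close>
lemma Hahn_Banach_dominated_extension:
  fixes p e :: "'a::real_vector \<Rightarrow> real"
  assumes p: "sublinear p" and Y: "subspace Y" and e: "linear e"
    and ep: "\<And>y. y \<in> Y \<Longrightarrow> e y \<le> p y"
  obtains f where "linear f" "f \<le> p" "\<And>y. y \<in> Y \<Longrightarrow> f y = e y"
proof -
  obtain q where q: "sublinear q" "q \<le> p" and eq: "\<And>y. y \<in> Y \<Longrightarrow> e y \<le> q y"
    and min: "\<And>r. sublinear r \<Longrightarrow> r \<le> q \<Longrightarrow> (\<And>y. y \<in> Y \<Longrightarrow> e y \<le> r y) \<Longrightarrow> r = q"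
    using minimal_sublinear[OF p ep] by blast
  have halfspace_cut_eq: "q x \<le> c" if c: "- q (- x) \<le> c"
    and *: "\<And>y t. y \<in> Y \<Longrightarrow> t \<ge> 0 \<Longrightarrow> e y \<le> q (y - t *\<^sub>R x) + t * c" for x c
  proof -
    have "halfspace_cut q x c = q"
      by (rule min[OF sublinear_halfspace_cut[OF q(1) c] halfspace_cut_le_self[OF q(1) c]])
        (rule halfspace_cut_ge[OF q(1) c], rule *)
    then show ?thesis using halfspace_cut_at[OF q(1) c] by simp
  qed
  have qe: "q y = e y" if y: "y \<in> Y" for y
  proof -
    have "- y \<in> Y" using subspace_neg[OF Y y] .
    have "q (- (- y)) \<le> - e (- y)"
    proof (rule halfspace_cut_eq)
      show "- q (- (- (- y))) \<le> - e (- y)"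
        using eq[OF \<open>- y \<in> Y\<close>] by simp
      fix z t assume z: "z \<in> Y" and "t \<ge> (0::real)"
      have "z - t *\<^sub>R - (- y) \<in> Y"
        by (intro subspace_diff[OF Y] subspace_scale[OF Y]) (use y z in auto)
      from eq[OF this] show "e z \<le> q (z - t *\<^sub>R - (- y)) + t * - e (- y)"
        using e by (simp add: linear_diff linear_scale linear_neg)
    qed
    then show ?thesis using eq[OF y] e by (simp add: linear_neg)
  qed
  have "q x \<le> - q (- x)" for x
  proof (rule halfspace_cut_eq)
    fix y t assume y: "y \<in> Y" and t: "t \<ge> (0::real)"
    have "q (t *\<^sub>R (- x)) \<le> q (y - t *\<^sub>R x) + q (- y)"
      using sublinear_add[OF q(1), of "y - t *\<^sub>R x" "- y"] by simp
    moreover have "q (t *\<^sub>R (- x)) = t * q (- x)"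
      by (rule sublinear_scale[OF q(1) t])
    moreover have "q (- y) = - e y"
      using qe[OF subspace_neg[OF Y y]] e by (simp add: linear_neg)
    ultimately show "e y \<le> q (y - t *\<^sub>R x) + t * - q (- x)" by simp
  qed simp
  then have "linear q" by (rule sublinear_odd_imp_linear[OF q(1)])
  then show ?thesis using q(2) qe by (rule that)
qed

section \<open>The dual ball\<close>

definition dual_ball :: "('a::real_normed_vector \<Rightarrow> real) set" where
  "dual_ball = {f. linear f \<and> (\<forall>x. f x \<le> norm x)}"

lemma dual_ballD:
  assumes "f \<in> dual_ball"
  shows "linear f" "f x \<le> norm x" "- f x \<le> norm x" "\<bar>f x\<bar> \<le> norm x" "\<bar>f x - f y\<bar> \<le> norm (x - y)"
proof -
  show l: "linear f" using assms by (simp add: dual_ball_def)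
  have *: "f z \<le> norm z" for z using assms by (simp add: dual_ball_def)
  have **: "\<bar>f z\<bar> \<le> norm z" for z
    using *[of z] *[of "- z"] by (simp add: linear_neg[OF l])
  show "f x \<le> norm x" "- f x \<le> norm x" "\<bar>f x\<bar> \<le> norm x"
    using **[of x] by auto
  show "\<bar>f x - f y\<bar> \<le> norm (x - y)"
    using **[of "x - y"] by (simp add: linear_diff[OF l])
qed

lemma dual_ball_midpoint:
  assumes f: "f \<in> dual_ball" and g: "g \<in> dual_ball"
  shows "(\<lambda>x. (f x + g x) / 2) \<in> dual_ball"
proof -
  note l = dual_ballD(1)[OF f] dual_ballD(1)[OF g]
  have "linear (\<lambda>x. (f x + g x) / 2)"
    by (rule linearI) (simp_all add: linear_add[OF l(1)] linear_add[OF l(2)]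
        linear_scale[OF l(1)] linear_scale[OF l(2)] field_simps)
  moreover have "(f x + g x) / 2 \<le> norm x" for x
    using dual_ballD(2)[OF f, of x] dual_ballD(2)[OF g, of x] by simp
  ultimately show ?thesis by (simp add: dual_ball_def)
qed

text \<open>The functional is any linear one below the norm cut by the half-space \<open>f (- x) \<le> - norm x\<close>.\<close>
lemma norming_functional: "\<exists>f\<in>dual_ball. f x = norm x"
proof -
  have c: "- norm (- (- x)) \<le> - norm x" by simp
  note s = sublinear_halfspace_cut[OF sublinear_norm c] halfspace_cut_le_self[OF sublinear_norm c]
    halfspace_cut_at[OF sublinear_norm c]
  obtain f where f: "linear f" "f \<le> halfspace_cut norm (- x) (- norm x)"
    by (rule Hahn_Banach_dominated_extension[OF s(1), of "{0}" "\<lambda>x. 0"])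
       (auto simp: sublinear_zero[OF s(1)] linear_iff)
  have "f z \<le> norm z" for z
    using f(2) s(2) by (auto simp: le_fun_def intro: order_trans)
  then have db: "f \<in> dual_ball" using f(1) by (simp add: dual_ball_def)
  have "f (- x) \<le> - norm x"
    using f(2) s(3) by (auto simp: le_fun_def intro: order_trans)
  then have "f x = norm x"
    using dual_ballD(2)[OF db, of x] by (simp add: linear_neg[OF f(1)])
  with db show ?thesis by blast
qed

text \<open>The theorem of Banach and Alaoglu: the function space carries the product topology, so this is
the theorem of Tychonoff together with the closedness of the linearity conditions.\<close>
lemma compact_dual_ball: "compact (dual_ball :: ('a::real_normed_vector \<Rightarrow> real) set)"
proof -
  let ?P = "PiE UNIV (\<lambda>x::'a. {- norm x .. norm x})"
  have "compactin (product_topology (\<lambda>_. euclidean) UNIV) ?P"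
    by (simp add: compactin_PiE)
  then have P: "compact ?P"
    by (simp add: euclidean_product_topology)
  have ev: "continuous_on UNIV (\<lambda>f::'a \<Rightarrow> real. f x)" for x
    by (rule continuous_on_product_coordinates)
  have "dual_ball = ?P \<inter> (\<Inter>x. \<Inter>y. {f. f (x + y) = f x + f y}) \<inter> (\<Inter>t. \<Inter>x. {f. f (t *\<^sub>R x) = t * f x})"
  proof (intro equalityI subsetI)
    fix f :: "'a \<Rightarrow> real" assume f: "f \<in> dual_ball"
    show "f \<in> ?P \<inter> (\<Inter>x. \<Inter>y. {f. f (x + y) = f x + f y}) \<inter> (\<Inter>t. \<Inter>x. {f. f (t *\<^sub>R x) = t * f x})"
      using dual_ballD[OF f] by (auto simp: abs_le_iff linear_add linear_scale minus_le_iff)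
  next
    fix f :: "'a \<Rightarrow> real"
    assume "f \<in> ?P \<inter> (\<Inter>x. \<Inter>y. {f. f (x + y) = f x + f y}) \<inter> (\<Inter>t. \<Inter>x. {f. f (t *\<^sub>R x) = t * f x})"
    then show "f \<in> dual_ball"
      by (auto simp: dual_ball_def PiE_iff intro!: linearI)
  qed
  moreover have cl1: "closed (\<Inter>x. \<Inter>y. {f. f (x + y) = f x + f y} :: ('a \<Rightarrow> real) set)"
    by (intro closed_INT ballI closed_Collect_eq continuous_intros ev)
  moreover have cl2: "closed (\<Inter>t. \<Inter>x. {f. f (t *\<^sub>R x) = t * f x} :: ('a \<Rightarrow> real) set)"
    by (intro closed_INT ballI closed_Collect_eq continuous_intros ev)
  ultimately show ?thesis
    using compact_Int_closed[OF compact_Int_closed[OF P cl1] cl2] by simp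
qed

section \<open>Slices and separable duals\<close>

text \<open>A slice of \<open>E\<close> by a point of \<open>Y\<close> that is small as a set of functionals on \<open>Y\<close>. If \<open>Y\<close> were the
whole space, such a point would be one of Frechet differentiability of the support function \<open>g\<close> of
\<open>E\<close>. On a proper subspace the points of differentiability of \<open>g\<close> may all lie outside \<open>Y\<close>.
So \<open>g\<close> is replaced by a minimal sublinear \<open>p\<close> that dominates it on \<open>Y\<close>. A point \<open>x\<close> of
differentiability of \<open>p\<close> gives a small slice of the functionals below \<open>p\<close>; by minimality, what is
left after removing this slice no longer dominates \<open>g\<close> at some \<open>y\<close> in \<open>Y\<close>, and therefore the
extension of every functional in a slice of \<open>E\<close> at \<open>y\<close> lies in the small slice at \<open>x\<close>.\<close>
lemma dual_ball_slice:
  fixes Y :: "'a::banach set"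
  assumes asp: "asplund_space TYPE('a)" and Y: "subspace Y"
    and E: "E \<subseteq> dual_ball" "E \<noteq> {}" and \<epsilon>: "\<epsilon> > 0"
  obtains y \<beta> where "y \<in> Y" "\<beta> > 0"
    "\<And>e e' h. e \<in> E \<Longrightarrow> e' \<in> E \<Longrightarrow> e y > (SUP f\<in>E. f y) - \<beta> \<Longrightarrow> e' y > (SUP f\<in>E. f y) - \<beta>
       \<Longrightarrow> h \<in> Y \<Longrightarrow> \<bar>e h - e' h\<bar> \<le> \<epsilon> * norm h"
proof -
  define g where "g y = (SUP f\<in>E. f y)" for y
  have bdd: "bdd_above ((\<lambda>f. f y) ` E)" for y
    by (rule bdd_aboveI2[where M = "norm y"]) (use E dual_ballD(2) in blast)
  have g_ge: "e y \<le> g y" if "e \<in> E" for e y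
    unfolding g_def by (rule cSUP_upper[OF that bdd])
  have g_norm: "g y \<le> norm y" for y
    unfolding g_def by (rule cSUP_least) (use E dual_ballD(2) in blast)+
  obtain p where p: "sublinear p" "p \<le> norm" and gp: "\<And>y. y \<in> Y \<Longrightarrow> g y \<le> p y"
    and min: "\<And>q. sublinear q \<Longrightarrow> q \<le> p \<Longrightarrow> (\<And>y. y \<in> Y \<Longrightarrow> g y \<le> q y) \<Longrightarrow> q = p"
    using minimal_sublinear[OF sublinear_norm, of Y g] g_norm by blast
  have plip: "p x - p y \<le> norm (x - y)" for x y
    using sublinear_add[OF p(1), of "x - y" y] p(2) by (simp add: le_fun_def) (smt (verit))
  have cont: "continuous_on UNIV p"
  proof (rule continuous_onI)
    fix x e assume "e > (0::real)"
    then show "\<exists>d>0. \<forall>x'\<in>UNIV. dist x' x < d \<longrightarrow> dist (p x') (p x) \<le> e"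
    proof (intro exI[of _ e] conjI ballI impI)
      fix x' assume "dist x' x < e"
      then show "dist (p x') (p x) \<le> e"
        using plip[of x x'] plip[of x' x] by (simp add: dist_norm abs_le_iff norm_minus_commute)
    qed
  qed
  have conv: "convex_on UNIV p"
    unfolding convex_on_def
    using sublinear_add[OF p(1)] sublinear_scale[OF p(1)] by (simp, metis)
  have "open (UNIV :: 'a set) \<and> convex (UNIV :: 'a set) \<and> continuous_on UNIV p \<and> convex_on UNIV p"
    using cont conv by simp
  then obtain S where S: "UNIV \<subseteq> closure S" "\<forall>x\<in>S. p differentiable (at x)"
    using asp unfolding asplund_space_def by blast
  have "S \<noteq> {}" using S(1) by auto
  then obtain x where "x \<in> S" by blast
  then obtain p' where p': "(p has_derivative p') (at x)"
    using S(2) unfolding differentiable_def by blast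
  have lp': "linear p'" using has_derivative_linear[OF p'] .
  define \<eta> where "\<eta> = \<epsilon> / 4"
  have \<eta>: "\<eta> > 0" using \<epsilon> by (simp add: \<eta>_def)
  obtain \<delta> where \<delta>: "\<delta> > 0" and diff: "\<And>z. norm (z - x) < \<delta> \<Longrightarrow> norm (p z - p x - p' (z - x)) \<le> \<eta> * norm (z - x)"
    using p' \<eta> unfolding has_derivative_at_alt by blast
  define \<alpha> where "\<alpha> = \<eta> * (\<delta> / 2)"
  have \<alpha>: "\<alpha> > 0" using \<eta> \<delta> by (simp add: \<alpha>_def)
  have "\<exists>y\<in>Y. \<exists>t\<ge>0. p (y - t *\<^sub>R x) + t * (p x - \<alpha>) < g y"
  proof (rule ccontr)
    assume "\<not> ?thesis"
    then have *: "g y \<le> p (y - t *\<^sub>R x) + t * (p x - \<alpha>)" if "y \<in> Y" "t \<ge> 0" for y t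
      using that by (meson not_le)
    obtain e where e: "e \<in> E" using E by blast
    then have "0 \<le> g 0" using g_ge[OF e, of 0] E(1) by (metis dual_ballD(1) linear_0 subsetD)
    also have "\<dots> \<le> p (- x) + (p x - \<alpha>)"
      using *[of 0 1] subspace_0[OF Y] by simp
    finally have c: "- p (- x) \<le> p x - \<alpha>" by simp
    have "halfspace_cut p x (p x - \<alpha>) = p"
      by (rule min[OF sublinear_halfspace_cut[OF p(1) c] halfspace_cut_le_self[OF p(1) c]])
        (rule halfspace_cut_ge[OF p(1) c], rule *)
    then show False using halfspace_cut_at[OF p(1) c] \<alpha> by simp
  qed
  then obtain y t where y: "y \<in> Y" and t: "t \<ge> 0" and less: "p (y - t *\<^sub>R x) + t * (p x - \<alpha>) < g y"
    by blast
  define \<beta> where "\<beta> = g y - (p (y - t *\<^sub>R x) + t * (p x - \<alpha>))"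
  have close: "e h - p' h \<le> 2 * \<eta> * norm h"
    if e: "e \<in> E" "e y > g y - \<beta>" and h: "h \<in> Y" for e h
  proof -
    have le: "linear e" using E(1) e(1) dual_ballD(1) by blast
    have ep: "e z \<le> p z" if "z \<in> Y" for z
      using g_ge[OF e(1), of z] gp[OF that] by simp
    obtain f where f: "linear f" "f \<le> p" "\<And>z. z \<in> Y \<Longrightarrow> f z = e z"
      using Hahn_Banach_dominated_extension[OF p(1) Y le ep] by blast
    have fp: "f z \<le> p z" for z using f(2) by (simp add: le_fun_def)
    have "e y = f (y - t *\<^sub>R x) + t * f x"
      using f(3)[OF y] by (simp add: linear_diff[OF f(1)] linear_scale[OF f(1)])
    also have "\<dots> \<le> p (y - t *\<^sub>R x) + t * f x"
      using fp by simp
    finally have "t * (p x - \<alpha>) < t * f x"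
      using e(2) by (simp add: \<beta>_def)
    then have fx: "p x - \<alpha> < f x"
      using t by (simp add: mult_less_cancel_left)
    show ?thesis
    proof (cases "h = 0")
      case True
      then show ?thesis using le lp' by (simp add: linear_0)
    next
      case False
      define s where "s = \<delta> / 2 / norm h"
      have s: "s > 0" using False \<delta> by (simp add: s_def)
      have ns: "norm (s *\<^sub>R h) = \<delta> / 2" using False \<delta> by (simp add: s_def)
      have "\<bar>p (x + s *\<^sub>R h) - p x - s * p' h\<bar> \<le> \<eta> * (\<delta> / 2)"
        using diff[of "x + s *\<^sub>R h"] \<delta> unfolding add_diff_cancel_left' ns
        by (simp add: linear_scale[OF lp'])
      then have "p (x + s *\<^sub>R h) - p x - s * p' h \<le> \<alpha>"
        unfolding \<alpha>_def by (rule order_trans[OF abs_ge_self])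
      moreover have "f x + s * f h \<le> p (x + s *\<^sub>R h)"
        using fp[of "x + s *\<^sub>R h"] by (simp add: linear_add[OF f(1)] linear_scale[OF f(1)])
      ultimately have "s * f h - s * p' h \<le> 2 * \<alpha>"
        using fx by linarith
      then have "s * (f h - p' h) \<le> 2 * \<eta> * (\<delta> / 2)"
        by (simp add: \<alpha>_def algebra_simps)
      also have "\<delta> / 2 = s * norm h" using False by (simp add: s_def)
      finally have "s * (f h - p' h) \<le> s * (2 * \<eta> * norm h)"
        by (simp add: mult_ac)
      then show ?thesis using s f(3)[OF h] by simp
    qed
  qed
  show thesis
  proof (rule that[OF y])
    show "\<beta> > 0" using less by (simp add: \<beta>_def)
    fix e e' h assume e: "e \<in> E" "e' \<in> E" and big: "e y > (SUP f\<in>E. f y) - \<beta>" "e' y > (SUP f\<in>E. f y) - \<beta>"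
      and h: "h \<in> Y"
    have "linear e" "linear e'" using E(1) e dual_ballD(1) by blast+
    then show "\<bar>e h - e' h\<bar> \<le> \<epsilon> * norm h"
      using close[of e h] close[of e "- h"] close[of e' h] close[of e' "- h"] e big h subspace_neg[OF Y h]
      by (simp add: g_def \<eta>_def linear_neg lp' abs_le_iff)
  qed
qed

text \<open>A maximal family \<open>E\<close> of functionals that are \<open>\<epsilon>\<close>-separated on \<open>Y\<close> is an \<open>\<epsilon>\<close>-net, and it has to be
shown countable. If it is not, discard all countable slices by points of \<open>Q\<close> at rational heights.
There are only countably many of them, so an uncountable family \<open>F\<close> remains, and none of its nonempty
slices by points of \<open>Y\<close> is a single point. This contradicts \<open>dual_ball_slice\<close>, because two functionals
in a small slice are not \<open>\<epsilon>\<close>-separated.\<close>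
lemma dual_ball_net:
  fixes Y :: "'a::banach set"
  assumes asp: "asplund_space TYPE('a)" and Y: "subspace Y"
    and Q: "countable Q" "Y \<subseteq> closure Q" and \<epsilon>: "\<epsilon> > 0"
  obtains D where "countable D" "D \<subseteq> dual_ball"
    "\<And>f. f \<in> dual_ball \<Longrightarrow> \<exists>d\<in>D. \<forall>y\<in>Y. \<bar>f y - d y\<bar> \<le> \<epsilon> * norm y"
proof -
  define close where "close f d \<longleftrightarrow> (\<forall>y\<in>Y. \<bar>f y - d y\<bar> \<le> \<epsilon> * norm y)" for f d :: "'a \<Rightarrow> real"
  define \<A> where "\<A> = {E. E \<subseteq> dual_ball \<and> (\<forall>e\<in>E. \<forall>e'\<in>E. close e e' \<longrightarrow> e = e')}"
  have "\<exists>M\<in>\<A>. \<forall>X\<in>\<A>. M \<subseteq> X \<longrightarrow> X = M"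
  proof (rule subset_Zorn')
    fix C assume C: "subset.chain \<A> C"
    show "\<Union>C \<in> \<A>"
      unfolding \<A>_def
    proof (intro CollectI conjI ballI impI)
      show "\<Union>C \<subseteq> dual_ball" using C by (auto simp: subset_chain_def \<A>_def)
      fix e e' assume e: "e \<in> \<Union>C" "e' \<in> \<Union>C" and cl: "close e e'"
      then obtain A B where AB: "e \<in> A" "A \<in> C" "e' \<in> B" "B \<in> C" by blast
      then have "A \<subseteq> B \<or> B \<subseteq> A" "A \<in> \<A>" "B \<in> \<A>" using C by (auto simp: subset_chain_def)
      then show "e = e'" using AB cl by (auto simp: \<A>_def)
    qed
  qed
  then obtain E where E: "E \<subseteq> dual_ball" "\<And>e e'. e \<in> E \<Longrightarrow> e' \<in> E \<Longrightarrow> close e e' \<Longrightarrow> e = e'"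
    and max: "\<And>X. X \<in> \<A> \<Longrightarrow> E \<subseteq> X \<Longrightarrow> X = E"
    by (auto simp: \<A>_def)
  have close_sym: "close f d \<longleftrightarrow> close d f" for f d by (simp add: close_def abs_minus_commute)
  have net: "\<exists>d\<in>E. close f d" if f: "f \<in> dual_ball" for f
  proof (rule ccontr)
    assume no: "\<not> ?thesis"
    then have "insert f E \<in> \<A>" using E f close_sym by (auto simp: \<A>_def)
    then have "f \<in> E" using max by blast
    moreover have "close f f" using \<epsilon> by (simp add: close_def)
    ultimately show False using no by blast
  qed
  have "countable E"
  proof (rule ccontr)
    assume unc: "uncountable E"
    define sl where "sl = (\<lambda>(q::'a, a::rat). {e\<in>E. e q > real_of_rat a})"
    define N where "N = (\<Union>i\<in>{i\<in>Q \<times> UNIV. countable (sl i)}. sl i)"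
    have "countable N"
      unfolding N_def using Q(1) by (intro countable_UN) (auto intro: countable_subset[of _ "Q \<times> UNIV"])
    define F where "F = E - N"
    have uF: "uncountable F" unfolding F_def using unc \<open>countable N\<close> by (rule uncountable_minus_countable)
    have F: "F \<subseteq> dual_ball" using E(1) by (auto simp: F_def)
    have F0: "F \<noteq> {}" using uF by (metis countable_empty)
    obtain y \<beta> where y: "y \<in> Y" and \<beta>: "\<beta> > 0" and slice:
      "\<And>e e' h. e \<in> F \<Longrightarrow> e' \<in> F \<Longrightarrow> e y > (SUP f\<in>F. f y) - \<beta> \<Longrightarrow> e' y > (SUP f\<in>F. f y) - \<beta>
       \<Longrightarrow> h \<in> Y \<Longrightarrow> \<bar>e h - e' h\<bar> \<le> \<epsilon> * norm h"
      using dual_ball_slice[OF asp Y F F0 \<epsilon>] by blast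
    have one: "e = e'" if "e \<in> F" "e' \<in> F" "e y > (SUP f\<in>F. f y) - \<beta>" "e' y > (SUP f\<in>F. f y) - \<beta>" for e e'
      using slice[OF that] that(1,2) E(2)[of e e'] by (auto simp: close_def F_def)
    have bdd: "bdd_above ((\<lambda>f. f y) ` F)"
      by (rule bdd_aboveI2[where M = "norm y"]) (use F dual_ballD(2) in blast)
    obtain e0 where e0: "e0 \<in> F" "e0 y > (SUP f\<in>F. f y) - \<beta> / 2"
      using less_cSUP_iff[OF F0 bdd, of "(SUP f\<in>F. f y) - \<beta> / 2"] \<beta> by auto
    obtain q where q: "q \<in> Q" "dist q y < \<beta> / 8"
      using Q(2) y \<beta> closure_approachable[of y Q] by (meson subsetD zero_less_divide_iff zero_less_numeral)
    have near: "\<bar>e q - e y\<bar> < \<beta> / 8" if "e \<in> F" for e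
      using dual_ballD(5)[of e q y] that F q(2) by (auto simp: dist_norm)
    obtain a where a: "e0 q - \<beta> / 8 < real_of_rat a" "real_of_rat a < e0 q"
      using of_rat_dense[of "e0 q - \<beta> / 8" "e0 q"] \<beta> by auto
    have "e0 \<in> sl (q, a)" using a e0 by (auto simp: sl_def F_def)
    then have "uncountable (sl (q, a))"
      using e0(1) q(1) by (auto simp: F_def N_def)
    then have "uncountable (sl (q, a) - N - {e0})"
      using \<open>countable N\<close> by (intro uncountable_minus_countable) auto
    then have "sl (q, a) - N - {e0} \<noteq> {}" by (metis countable_empty)
    then obtain e1 where e1: "e1 \<in> sl (q, a)" "e1 \<notin> N" "e1 \<noteq> e0" by blast
    have e1F: "e1 \<in> F" using e1 by (auto simp: sl_def F_def)
    have "e1 q > real_of_rat a" using e1 by (auto simp: sl_def)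
    then have "e1 y > (SUP f\<in>F. f y) - \<beta>"
      using near[OF e1F] near[OF e0(1)] a(1) e0(2) by linarith
    moreover have "e0 y > (SUP f\<in>F. f y) - \<beta>" using e0(2) \<beta> by linarith
    ultimately show False using one[OF e1F e0(1)] e1(3) by blast
  qed
  then show thesis using E(1) net by (intro that[of E]) (auto simp: close_def)
qed

lemma dual_ball_separable:
  fixes Y :: "'a::banach set"
  assumes asp: "asplund_space TYPE('a)" and Y: "subspace Y"
    and Q: "countable Q" "Y \<subseteq> closure Q"
  obtains d :: "nat \<Rightarrow> 'a \<Rightarrow> real" where "range d \<subseteq> dual_ball"
    "\<And>f \<epsilon>. f \<in> dual_ball \<Longrightarrow> \<epsilon> > 0 \<Longrightarrow> \<exists>n. \<forall>y\<in>Y. \<bar>f y - d n y\<bar> \<le> \<epsilon> * norm y"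
proof -
  have "\<exists>D. countable D \<and> D \<subseteq> dual_ball \<and>
      (\<forall>f\<in>dual_ball. \<exists>d\<in>D. \<forall>y\<in>Y. \<bar>f y - d y\<bar> \<le> inverse (real (Suc k)) * norm y)" for k
    using dual_ball_net[OF asp Y Q, of "inverse (real (Suc k))"] by (metis inverse_positive_iff_positive of_nat_0_less_iff zero_less_Suc)
  then obtain D where D: "\<And>k. countable (D k)" "\<And>k. D k \<subseteq> dual_ball"
      "\<And>k f. f \<in> dual_ball \<Longrightarrow> \<exists>d\<in>D k. \<forall>y\<in>Y. \<bar>f y - d y\<bar> \<le> inverse (real (Suc k)) * norm y"
    by metis
  have "(\<lambda>_. 0) \<in> dual_ball" by (simp add: dual_ball_def linear_iff)
  then have ne: "(\<Union>k. D k) \<noteq> {}" using D(3)[of "\<lambda>_. 0" 0] by auto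
  have "countable (\<Union>k. D k)" using D(1) by blast
  from from_nat_into_surj[OF this] range_from_nat_into[OF ne this]
  have r: "range (from_nat_into (\<Union>k. D k)) = (\<Union>k. D k)" by blast
  show thesis
  proof (rule that[of "from_nat_into (\<Union>k. D k)"])
    show "range (from_nat_into (\<Union>k. D k)) \<subseteq> dual_ball" using r D(2) by blast
    fix f :: "'a \<Rightarrow> real" and \<epsilon> :: real assume f: "f \<in> dual_ball" and "\<epsilon> > 0"
    then obtain k where k: "inverse (real (Suc k)) < \<epsilon>" using reals_Archimedean by blast
    obtain d where d: "d \<in> D k" "\<forall>y\<in>Y. \<bar>f y - d y\<bar> \<le> inverse (real (Suc k)) * norm y"
      using D(3)[OF f] by blast
    then have "d \<in> range (from_nat_into (\<Union>k. D k))" using r by blast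
    moreover have "\<forall>y\<in>Y. \<bar>f y - d y\<bar> \<le> \<epsilon> * norm y"
    proof
      fix y assume "y \<in> Y"
      then have "\<bar>f y - d y\<bar> \<le> inverse (real (Suc k)) * norm y" using d(2) by blast
      also have "\<dots> \<le> \<epsilon> * norm y" using k by (intro mult_right_mono) auto
      finally show "\<bar>f y - d y\<bar> \<le> \<epsilon> * norm y" .
    qed
    ultimately show "\<exists>n. \<forall>y\<in>Y. \<bar>f y - from_nat_into (\<Union>k. D k) n y\<bar> \<le> \<epsilon> * norm y" by auto
  qed
qed

section \<open>Smooth approximation of the norm\<close>

context
  fixes Y :: "'a::banach set" and d :: "nat \<Rightarrow> 'a \<Rightarrow> real" and \<theta> :: real
  assumes Y: "subspace Y" and d: "range d \<subseteq> dual_ball" and \<theta>: "\<theta> > 0"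
    and dense: "\<And>f \<epsilon>. f \<in> dual_ball \<Longrightarrow> \<epsilon> > 0 \<Longrightarrow> \<exists>n. \<forall>y\<in>Y. \<bar>f y - d n y\<bar> \<le> \<epsilon> * norm y"
begin

text \<open>The distance between \<open>f\<close> and \<open>d n\<close> in the dual of \<open>Y\<close>. The supremum needs no absolute value
because \<open>Y\<close> is symmetric.\<close>
definition gap :: "nat \<Rightarrow> ('a \<Rightarrow> real) \<Rightarrow> real" where
  "gap n f = (SUP y\<in>{y\<in>Y. norm y \<le> 1}. f y - d n y)"

text \<open>A weak-star lower semicontinuous convex function on the dual ball with values in \<open>[0, 1]\<close>. Its
midpoint defect controls every difference of gaps, as squaring makes each term strictly convex
in the gap.\<close>
definition penalty :: "('a \<Rightarrow> real) \<Rightarrow> real" where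
  "penalty f = (\<Sum>n. (1/2) ^ Suc n * (gap n f)\<^sup>2 / 4)"

definition smooth_norm :: "'a \<Rightarrow> real" where
  "smooth_norm z = (SUP f\<in>dual_ball. f z - \<theta> * penalty f)"

lemma d_ball: "d n \<in> dual_ball"
  using d by blast

lemma diff_le_2:
  assumes "f \<in> dual_ball" "norm y \<le> 1"
  shows "f y - d n y \<le> 2"
  using dual_ballD(2)[OF assms(1), of y] dual_ballD(3)[OF d_ball, of n y] assms(2) by linarith

lemma gap_bdd: "f \<in> dual_ball \<Longrightarrow> bdd_above ((\<lambda>y. f y - d n y) ` {y\<in>Y. norm y \<le> 1})"
  by (rule bdd_aboveI2[where M = 2]) (simp add: diff_le_2)

lemma gap_upper: "f \<in> dual_ball \<Longrightarrow> y \<in> Y \<Longrightarrow> norm y \<le> 1 \<Longrightarrow> f y - d n y \<le> gap n f"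
  unfolding gap_def by (rule cSUP_upper[OF _ gap_bdd]) auto

lemma gap_least:
  assumes "\<And>y. y \<in> Y \<Longrightarrow> norm y \<le> 1 \<Longrightarrow> f y - d n y \<le> m"
  shows "gap n f \<le> m"
  unfolding gap_def by (rule cSUP_least) (use assms subspace_0[OF Y] in auto)

lemma gap_nonneg: "f \<in> dual_ball \<Longrightarrow> 0 \<le> gap n f"
  using gap_upper[of f 0 n] subspace_0[OF Y] by (simp add: linear_0 dual_ballD(1) d_ball)

lemma gap_le_2: "f \<in> dual_ball \<Longrightarrow> gap n f \<le> 2"
  by (rule gap_least) (rule diff_le_2)

lemma gap_bound:
  assumes f: "f \<in> dual_ball" and y: "y \<in> Y"
  shows "\<bar>f y - d n y\<bar> \<le> gap n f * norm y"
proof (cases "y = 0")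
  case True
  then show ?thesis by (simp add: linear_0 dual_ballD(1) d_ball f)
next
  case False
  note lin = dual_ballD(1)[OF f] dual_ballD(1)[OF d_ball, of n]
  have *: "f u - d n u \<le> gap n f * norm u" if u: "u \<in> Y" "u \<noteq> 0" for u
  proof -
    have "f (inverse (norm u) *\<^sub>R u) - d n (inverse (norm u) *\<^sub>R u) \<le> gap n f"
      by (rule gap_upper[OF f]) (use u in \<open>auto intro: subspace_scale[OF Y]\<close>)
    then show ?thesis using u
      by (simp add: linear_scale[OF lin(1)] linear_scale[OF lin(2)] field_simps)
  qed
  show ?thesis
    using *[of y] *[of "- y"] False y subspace_neg[OF Y y]
    by (simp add: linear_neg[OF lin(1)] linear_neg[OF lin(2)] abs_le_iff)
qed

lemma gap_midpoint:
  assumes f: "f \<in> dual_ball" and g: "g \<in> dual_ball"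
  shows "gap n (\<lambda>x. (f x + g x) / 2) \<le> (gap n f + gap n g) / 2"
proof (rule gap_least)
  fix y assume "y \<in> Y" "norm y \<le> 1"
  from gap_upper[OF f this, of n] gap_upper[OF g this, of n]
  show "(f y + g y) / 2 - d n y \<le> (gap n f + gap n g) / 2" by argo
qed

lemma penalty_term_le: "f \<in> dual_ball \<Longrightarrow> (1/2) ^ Suc n * (gap n f)\<^sup>2 / 4 \<le> (1/2) ^ Suc n"
  using power_mono[OF gap_le_2 gap_nonneg, of f n 2] by simp

lemma penalty_summable: "f \<in> dual_ball \<Longrightarrow> summable (\<lambda>n. (1/2) ^ Suc n * (gap n f)\<^sup>2 / 4)"
  by (rule summable_comparison_test'[OF sums_summable[OF power_half_series], where N = 0])
    (use penalty_term_le in auto)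

lemma penalty_nonneg: "f \<in> dual_ball \<Longrightarrow> 0 \<le> penalty f"
  unfolding penalty_def by (rule suminf_nonneg[OF penalty_summable]) auto

lemma penalty_le_1:
  assumes f: "f \<in> dual_ball"
  shows "penalty f \<le> 1"
proof -
  have "penalty f \<le> (\<Sum>n. (1/2) ^ Suc n)"
    unfolding penalty_def
    by (rule suminf_le[OF penalty_term_le[OF f] penalty_summable[OF f] sums_summable[OF power_half_series]])
  then show ?thesis using sums_unique[OF power_half_series] by simp
qed

text \<open>The parallelogram identity for the numbers \<open>gap n f\<close> and \<open>gap n g\<close>, summed over \<open>n\<close>.\<close>
lemma penalty_midpoint:
  assumes f: "f \<in> dual_ball" and g: "g \<in> dual_ball"
  shows "penalty (\<lambda>x. (f x + g x) / 2) + (1/2) ^ Suc m * ((gap m f - gap m g) / 2)\<^sup>2 / 4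
    \<le> (penalty f + penalty g) / 2"
proof -
  let ?h = "\<lambda>x. (f x + g x) / 2"
  have h: "?h \<in> dual_ball" by (rule dual_ball_midpoint[OF f g])
  define D where "D n = ((1/2) ^ Suc n * (gap n f)\<^sup>2 / 4 + (1/2) ^ Suc n * (gap n g)\<^sup>2 / 4) / 2
      - (1/2) ^ Suc n * (gap n ?h)\<^sup>2 / 4" for n
  have sums: "D sums ((penalty f + penalty g) / 2 - penalty ?h)"
    unfolding D_def penalty_def
    by (intro sums_diff sums_divide sums_add summable_sums penalty_summable f g h)
  have D: "(1/2) ^ Suc n * ((gap n f - gap n g) / 2)\<^sup>2 / 4 \<le> D n" for n
  proof -
    have "(gap n ?h)\<^sup>2 \<le> ((gap n f + gap n g) / 2)\<^sup>2"
      by (rule power_mono[OF gap_midpoint[OF f g] gap_nonneg[OF h]])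
    moreover have "((gap n f)\<^sup>2 + (gap n g)\<^sup>2) / 2 = ((gap n f + gap n g) / 2)\<^sup>2 + ((gap n f - gap n g) / 2)\<^sup>2"
      by (simp add: power2_eq_square field_simps)
    ultimately have "((gap n f - gap n g) / 2)\<^sup>2 \<le> ((gap n f)\<^sup>2 + (gap n g)\<^sup>2) / 2 - (gap n ?h)\<^sup>2"
      by linarith
    then have "(1/2) ^ Suc n / 4 * ((gap n f - gap n g) / 2)\<^sup>2
        \<le> (1/2) ^ Suc n / 4 * (((gap n f)\<^sup>2 + (gap n g)\<^sup>2) / 2 - (gap n ?h)\<^sup>2)"
      by (intro mult_left_mono) auto
    also have "\<dots> = D n" by (simp add: D_def algebra_simps add_divide_distrib)
    finally show ?thesis by simp
  qed
  have "D n \<ge> 0" for n using D[of n] by (rule order_trans[rotated]) simp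
  then have "sum D {m} \<le> suminf D"
    by (intro sum_le_suminf sums_summable[OF sums]) auto
  then have "D m \<le> suminf D" by simp
  then show ?thesis using D[of m] sums_unique[OF sums] by linarith
qed

text \<open>Lower semicontinuity: the condition on the right depends on finitely many values of \<open>f\<close> for each
choice of \<open>y\<close> and \<open>N\<close>, so the sublevel sets of the penalty are weak-star closed in the dual ball.\<close>
lemma penalty_le_iff:
  assumes f: "f \<in> dual_ball"
  shows "penalty f \<le> c \<longleftrightarrow>
    (\<forall>y N. (\<forall>n. y n \<in> Y \<and> norm (y n) \<le> 1) \<longrightarrow>
       (\<Sum>n<N. (1/2) ^ Suc n * (f (y n) - d n (y n))\<^sup>2 / 4) \<le> c)" (is "_ \<longleftrightarrow> ?R")
proof
  assume c: "penalty f \<le> c"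
  show ?R
  proof (intro allI impI)
    fix y :: "nat \<Rightarrow> 'a" and N assume y: "\<forall>n. y n \<in> Y \<and> norm (y n) \<le> 1"
    have "(f (y n) - d n (y n))\<^sup>2 \<le> (gap n f)\<^sup>2" for n
    proof -
      have "\<bar>f (y n) - d n (y n)\<bar> \<le> gap n f * norm (y n)"
        using y by (intro gap_bound[OF f]) auto
      also have "\<dots> \<le> gap n f * 1"
        using y gap_nonneg[OF f] by (intro mult_left_mono) auto
      finally show ?thesis using gap_nonneg[OF f] by (simp add: power2_le_iff_abs_le)
    qed
    then have "(\<Sum>n<N. (1/2) ^ Suc n * (f (y n) - d n (y n))\<^sup>2 / 4)
        \<le> (\<Sum>n<N. (1/2) ^ Suc n * (gap n f)\<^sup>2 / 4)"
      by (intro sum_mono) simp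
    also have "\<dots> \<le> penalty f"
      unfolding penalty_def by (rule sum_le_suminf[OF penalty_summable[OF f]]) auto
    finally show "(\<Sum>n<N. (1/2) ^ Suc n * (f (y n) - d n (y n))\<^sup>2 / 4) \<le> c"
      using c by linarith
  qed
next
  assume R: ?R
  have "\<exists>y. y \<in> Y \<and> norm y \<le> 1 \<and> gap n f - inverse (real (Suc k)) < f y - d n y" for n k
  proof (rule ccontr)
    assume "\<not> ?thesis"
    then have "gap n f \<le> gap n f - inverse (real (Suc k))"
      by (intro gap_least) (meson not_le)
    then show False by simp
  qed
  then have "\<forall>n. \<exists>v. \<forall>k. v k \<in> Y \<and> norm (v k) \<le> 1 \<and> gap n f - inverse (real (Suc k)) < f (v k) - d n (v k)"
    by (intro allI choice)
  then obtain v where v: "\<forall>n k. v n k \<in> Y \<and> norm (v n k) \<le> 1 \<and> gap n f - inverse (real (Suc k)) < f (v n k) - d n (v n k)"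
    by (auto dest: choice)
  define y where "y k n = v n k" for k n
  have y: "\<And>n k. y k n \<in> Y" "\<And>n k. norm (y k n) \<le> 1"
    "\<And>n k. gap n f - inverse (real (Suc k)) < f (y k n) - d n (y k n)"
    using v by (auto simp: y_def)
  have lim: "(\<lambda>k. f (y k n) - d n (y k n)) \<longlonglongrightarrow> gap n f" for n
  proof (rule tendsto_sandwich)
    show "(\<lambda>k. gap n f - inverse (real (Suc k))) \<longlonglongrightarrow> gap n f"
      using tendsto_diff[OF tendsto_const LIMSEQ_inverse_real_of_nat, of "gap n f"] by simp
    show "\<forall>\<^sub>F k in sequentially. gap n f - inverse (real (Suc k)) \<le> f (y k n) - d n (y k n)"
      using y(3) by (auto intro: less_imp_le always_eventually)
    show "\<forall>\<^sub>F k in sequentially. f (y k n) - d n (y k n) \<le> gap n f"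
      using gap_upper[OF f y(1,2)] by (auto intro: always_eventually)
  qed simp
  have "(\<Sum>n<N. (1/2) ^ Suc n * (gap n f)\<^sup>2 / 4) \<le> c" for N
  proof (rule LIMSEQ_le_const2)
    show "(\<lambda>k. \<Sum>n<N. (1/2) ^ Suc n * (f (y k n) - d n (y k n))\<^sup>2 / 4)
        \<longlonglongrightarrow> (\<Sum>n<N. (1/2) ^ Suc n * (gap n f)\<^sup>2 / 4)"
      by (intro tendsto_intros lim) simp
    show "\<exists>K. \<forall>k\<ge>K. (\<Sum>n<N. (1/2) ^ Suc n * (f (y k n) - d n (y k n))\<^sup>2 / 4) \<le> c"
      using R y(1,2) by blast
  qed
  then show "penalty f \<le> c"
    unfolding penalty_def by (rule suminf_le_const[OF penalty_summable[OF f]])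
qed

lemma smooth_norm_bdd: "bdd_above ((\<lambda>f. f z - \<theta> * penalty f) ` dual_ball)"
proof (rule bdd_aboveI2)
  fix f :: "'a \<Rightarrow> real" assume f: "f \<in> dual_ball"
  have "0 \<le> \<theta> * penalty f" using penalty_nonneg[OF f] \<theta> by simp
  then show "f z - \<theta> * penalty f \<le> norm z" using dual_ballD(2)[OF f, of z] by linarith
qed

lemma dual_ball_nonempty: "dual_ball \<noteq> ({} :: ('a \<Rightarrow> real) set)"
  using norming_functional by blast

lemma smooth_norm_ge: "f \<in> dual_ball \<Longrightarrow> f z - \<theta> * penalty f \<le> smooth_norm z"
  unfolding smooth_norm_def by (rule cSUP_upper[OF _ smooth_norm_bdd])

text \<open>A weak-star upper semicontinuous function attains its supremum on the weak-star compact dual ball.\<close>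
lemma smooth_norm_attained: "\<exists>f\<in>dual_ball. smooth_norm z = f z - \<theta> * penalty f"
proof -
  define J where "J = {c. c < smooth_norm z}"
  define T where "T c = {f. \<forall>y N. (\<forall>n. y n \<in> Y \<and> norm (y n) \<le> 1) \<longrightarrow>
       (\<Sum>n<N. (1/2) ^ Suc n * (f (y n) - d n (y n))\<^sup>2 / 4) \<le> (f z - c) / \<theta>}" for c
  have T: "f \<in> T c \<longleftrightarrow> c \<le> f z - \<theta> * penalty f" if "f \<in> dual_ball" for f c
    using penalty_le_iff[OF that, of "(f z - c) / \<theta>"] \<theta> unfolding T_def
    by (auto simp: field_simps)
  have ev: "continuous_on UNIV (\<lambda>f::'a \<Rightarrow> real. f x)" for x
    by (rule continuous_on_product_coordinates)
  have "dual_ball \<inter> (\<Inter>c\<in>J. T c) \<noteq> {}"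
  proof (rule compact_imp_fip_image[OF compact_dual_ball])
    fix c
    show "closed (T c)"
      unfolding T_def
      by (intro closed_Collect_all closed_Collect_imp open_Collect_const closed_Collect_le
          continuous_intros ev) (use \<theta> in auto)
  next
    fix I' assume I': "finite I'" "I' \<subseteq> J"
    show "dual_ball \<inter> (\<Inter>c\<in>I'. T c) \<noteq> {}"
    proof (cases "I' = {}")
      case True
      then show ?thesis using dual_ball_nonempty by simp
    next
      case False
      then have "Max I' < smooth_norm z" using I' Max_in[OF I'(1) False] by (auto simp: J_def)
      then obtain f where f: "f \<in> dual_ball" "Max I' < f z - \<theta> * penalty f"
        unfolding smooth_norm_def using less_cSUP_iff[OF dual_ball_nonempty smooth_norm_bdd] by blast
      have "f \<in> T c" if "c \<in> I'" for c
        using T[OF f(1)] f(2) Max_ge[OF I'(1) that] by simp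
      then show ?thesis using f(1) by blast
    qed
  qed
  then obtain f where f: "f \<in> dual_ball" "\<And>c. c \<in> J \<Longrightarrow> f \<in> T c" by blast
  have "smooth_norm z \<le> f z - \<theta> * penalty f"
    by (rule dense_le) (use f T[OF f(1)] in \<open>auto simp: J_def\<close>)
  then show ?thesis using smooth_norm_ge[OF f(1), of z] f(1) by (intro bexI[of _ f]) auto
qed

lemma smooth_norm_le: "smooth_norm z \<le> norm z"
proof -
  obtain f where f: "f \<in> dual_ball" "smooth_norm z = f z - \<theta> * penalty f"
    using smooth_norm_attained by blast
  have "0 \<le> \<theta> * penalty f" using penalty_nonneg[OF f(1)] \<theta> by simp
  then show ?thesis using f(2) dual_ballD(2)[OF f(1), of z] by linarith
qed

lemma smooth_norm_lower: "norm z - \<theta> \<le> smooth_norm z"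
proof -
  obtain f where f: "f \<in> dual_ball" "f z = norm z" using norming_functional by blast
  have "\<theta> * penalty f \<le> \<theta>" using penalty_le_1[OF f(1)] \<theta> by simp
  then show ?thesis using smooth_norm_ge[OF f(1), of z] f(2) by linarith
qed

lemma smooth_norm_lipschitz: "smooth_norm z - smooth_norm w \<le> norm (z - w)"
proof -
  obtain f where f: "f \<in> dual_ball" "smooth_norm z = f z - \<theta> * penalty f"
    using smooth_norm_attained by blast
  show ?thesis
    using smooth_norm_ge[OF f(1), of w] f(2) dual_ballD(5)[OF f(1), of z w] by linarith
qed

text \<open>Compare a near-maximizer \<open>f\<close> with the maximizer \<open>f0\<close>: the value at their midpoint does not exceed the
maximum, so the midpoint defect of the penalty is small, and \<open>gap m f\<close> is close to \<open>gap m f0\<close>.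
Choosing \<open>m\<close> with \<open>d m\<close> close to \<open>f0\<close> brings \<open>f\<close> close to \<open>d m\<close>, hence to \<open>f0\<close>.\<close>
lemma near_maximizer_close:
  assumes f0: "f0 \<in> dual_ball" "smooth_norm z = f0 z - \<theta> * penalty f0" and \<eta>: "\<eta> > 0"
  obtains \<alpha> where "\<alpha> > 0"
    "\<And>f h. f \<in> dual_ball \<Longrightarrow> smooth_norm z - \<alpha> \<le> f z - \<theta> * penalty f \<Longrightarrow> h \<in> Y
      \<Longrightarrow> \<bar>f h - f0 h\<bar> \<le> \<eta> * norm h"
proof -
  obtain m where m: "\<forall>y\<in>Y. \<bar>f0 y - d m y\<bar> \<le> \<eta> / 4 * norm y"
    using dense[OF f0(1), of "\<eta> / 4"] \<eta> by auto
  have gap0: "gap m f0 \<le> \<eta> / 4"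
  proof (rule gap_least)
    fix y assume y: "y \<in> Y" "norm y \<le> 1"
    then have "f0 y - d m y \<le> \<eta> / 4 * norm y" using m abs_le_D1 by blast
    also have "\<dots> \<le> \<eta> / 4 * 1" using y \<eta> by (intro mult_left_mono) auto
    finally show "f0 y - d m y \<le> \<eta> / 4" by simp
  qed
  \<comment> \<open>The midpoint defect of the penalized functional is at most \<open>\<alpha> / 2\<close>, and this bounds
    \<open>gap m f - gap m f0\<close> by \<open>\<eta> / 4\<close>.\<close>
  define \<alpha> where "\<alpha> = 2 * \<theta> * ((1/2) ^ Suc m * (\<eta> / 8)\<^sup>2 / 4)"
  show thesis
  proof (rule that)
    show "\<alpha> > 0" using \<theta> \<eta> by (simp add: \<alpha>_def)
    fix f h assume f: "f \<in> dual_ball" and near: "smooth_norm z - \<alpha> \<le> f z - \<theta> * penalty f" and h: "h \<in> Y"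
    let ?k = "\<lambda>x. (f x + f0 x) / 2"
    define \<delta> where "\<delta> = (1/2) ^ Suc m * ((gap m f - gap m f0) / 2)\<^sup>2 / 4"
    have k: "?k \<in> dual_ball" by (rule dual_ball_midpoint[OF f f0(1)])
    have "\<theta> * (penalty ?k + \<delta>) \<le> \<theta> * ((penalty f + penalty f0) / 2)"
      using penalty_midpoint[OF f f0(1), of m] \<theta> unfolding \<delta>_def by (intro mult_left_mono) auto
    moreover have "(f z + f0 z) / 2 - \<theta> * penalty ?k \<le> smooth_norm z"
      using smooth_norm_ge[OF k, of z] by simp
    ultimately have "\<theta> * \<delta> \<le> \<alpha> / 2"
      using near f0(2) by (simp add: algebra_simps add_divide_distrib)
    then have "\<delta> \<le> (1/2) ^ Suc m * (\<eta> / 8)\<^sup>2 / 4" using \<theta> by (simp add: \<alpha>_def)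
    then have "((gap m f - gap m f0) / 2)\<^sup>2 \<le> (\<eta> / 8)\<^sup>2" by (simp add: \<delta>_def)
    then have "(gap m f - gap m f0) / 2 \<le> \<eta> / 8" by (rule power2_le_imp_le) (use \<eta> in simp)
    then have gap1: "gap m f \<le> \<eta> / 2" using gap0 by argo
    note mult_right_mono[OF gap1 norm_ge_zero[of h]] mult_right_mono[OF gap0 norm_ge_zero[of h]]
    moreover have "0 \<le> \<eta> * norm h" using \<eta> by simp
    ultimately show "\<bar>f h - f0 h\<bar> \<le> \<eta> * norm h"
      using gap_bound[OF f h, of m] gap_bound[OF f0(1) h, of m] by linarith
  qed
qed

text \<open>The gradient is the maximizer at \<open>z\<close>: a maximizer at \<open>z + h\<close> is a near-maximizer at \<open>z\<close>, so it
differs from the one at \<open>z\<close> by little on \<open>Y\<close>.\<close>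
lemma smooth_norm_upper_gradient:
  "\<exists>g\<in>dual_ball. smooth_norm z \<le> g z \<and>
    (\<forall>\<eta>>0. \<exists>\<delta>>0. \<forall>h\<in>Y. norm h < \<delta> \<longrightarrow> smooth_norm (z + h) \<le> smooth_norm z + g h + \<eta> * norm h)"
proof -
  obtain f0 where f0: "f0 \<in> dual_ball" "smooth_norm z = f0 z - \<theta> * penalty f0"
    using smooth_norm_attained by blast
  show ?thesis
  proof (intro bexI[OF _ f0(1)] conjI allI impI)
    show "smooth_norm z \<le> f0 z" using f0(2) penalty_nonneg[OF f0(1)] \<theta> by simp
    fix \<eta> :: real assume \<eta>: "\<eta> > 0"
    obtain \<alpha> where \<alpha>: "\<alpha> > 0" and close:
      "\<And>f h. f \<in> dual_ball \<Longrightarrow> smooth_norm z - \<alpha> \<le> f z - \<theta> * penalty f \<Longrightarrow> h \<in> Y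
        \<Longrightarrow> \<bar>f h - f0 h\<bar> \<le> \<eta> * norm h"
      using near_maximizer_close[OF f0 \<eta>] by blast
    show "\<exists>\<delta>>0. \<forall>h\<in>Y. norm h < \<delta> \<longrightarrow> smooth_norm (z + h) \<le> smooth_norm z + f0 h + \<eta> * norm h"
    proof (intro exI[of _ "\<alpha> / 2"] conjI ballI impI)
      show "\<alpha> / 2 > 0" using \<alpha> by simp
      fix h assume h: "h \<in> Y" "norm h < \<alpha> / 2"
      obtain f where f: "f \<in> dual_ball" "smooth_norm (z + h) = f (z + h) - \<theta> * penalty f"
        using smooth_norm_attained by blast
      have fh: "f (z + h) = f z + f h" by (rule linear_add[OF dual_ballD(1)[OF f(1)]])
      have "smooth_norm z - \<alpha> \<le> f z - \<theta> * penalty f"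
        using smooth_norm_lipschitz[of z "z + h"] f(2) fh dual_ballD(2)[OF f(1), of h] h(2) by simp
      then have "\<bar>f h - f0 h\<bar> \<le> \<eta> * norm h" using close f(1) h(1) by blast
      then show "smooth_norm (z + h) \<le> smooth_norm z + f0 h + \<eta> * norm h"
        using smooth_norm_ge[OF f(1), of z] f(2) fh by linarith
    qed
  qed
qed

end

lemma smooth_norm_approximation:
  fixes Y :: "'a::banach set"
  assumes asp: "asplund_space TYPE('a)" and Y: "subspace Y"
    and Q: "countable Q" "Y \<subseteq> closure Q" and \<theta>: "\<theta> > 0"
  obtains G where "\<And>z. G z \<le> norm z" "\<And>z. norm z - \<theta> \<le> G z" "\<And>z w. G z - G w \<le> norm (z - w)"
    "\<And>z. \<exists>g\<in>dual_ball. G z \<le> g z \<and>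
      (\<forall>\<eta>>0. \<exists>\<delta>>0. \<forall>h\<in>Y. norm h < \<delta> \<longrightarrow> G (z + h) \<le> G z + g h + \<eta> * norm h)"
proof -
  obtain d :: "nat \<Rightarrow> 'a \<Rightarrow> real" where d: "range d \<subseteq> dual_ball"
    "\<And>f \<epsilon>. f \<in> dual_ball \<Longrightarrow> \<epsilon> > 0 \<Longrightarrow> \<exists>n. \<forall>y\<in>Y. \<bar>f y - d n y\<bar> \<le> \<epsilon> * norm y"
    by (rule dual_ball_separable[OF asp Y Q]) (rule that)
  note a = Y d(1) \<theta> d(2)
  show thesis
  proof (rule that[of "smooth_norm Y d \<theta>"])
    fix z w
    show "smooth_norm Y d \<theta> z \<le> norm z" by (rule smooth_norm_le[OF a])
    show "norm z - \<theta> \<le> smooth_norm Y d \<theta> z" by (rule smooth_norm_lower[OF a])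
    show "smooth_norm Y d \<theta> z - smooth_norm Y d \<theta> w \<le> norm (z - w)"
      by (rule smooth_norm_lipschitz[OF a])
  qed (rule smooth_norm_upper_gradient[OF a])
qed

section \<open>A smooth variational principle\<close>

text \<open>Finitely many terms are controlled by differentiability, and the remaining ones by the Lipschitz
constant \<open>1\<close> and the smallness of the tail of \<open>w\<close>.\<close>
lemma upper_gradient_suminf:
  fixes \<phi> g :: "nat \<Rightarrow> 'a::real_normed_vector \<Rightarrow> real" and w :: "nat \<Rightarrow> real"
  assumes w: "\<And>n. 0 \<le> w n" "summable w"
    and lip: "\<And>n y z. \<phi> n y - \<phi> n z \<le> norm (y - z)"
    and sm: "\<And>y. summable (\<lambda>n. w n * \<phi> n y)"
    and g: "\<And>n. g n \<in> dual_ball"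
    and ug: "\<And>n \<eta>. \<eta> > 0 \<Longrightarrow> \<exists>\<delta>>0. \<forall>h\<in>Y. norm h < \<delta> \<longrightarrow> \<phi> n (z + h) \<le> \<phi> n z + g n h + \<eta> * norm h"
    and \<eta>: "\<eta> > 0"
  shows "\<exists>\<delta>>0. \<forall>h\<in>Y. norm h < \<delta> \<longrightarrow>
    (\<Sum>n. w n * \<phi> n (z + h)) \<le> (\<Sum>n. w n * \<phi> n z) + (\<Sum>n. w n * g n h) + \<eta> * norm h"
proof -
  define W where "W = suminf w"
  have W: "W \<ge> 0" unfolding W_def by (rule suminf_nonneg[OF w(2,1)])
  define \<eta>' where "\<eta>' = \<eta> / (2 * (W + 1))"
  have \<eta>': "\<eta>' > 0" using \<eta> W by (simp add: \<eta>'_def)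
  have "(\<lambda>N. \<Sum>n. w (n + N)) \<longlonglongrightarrow> 0"
    by (rule suminf_exist_split2[OF w(2)])
  then have "\<forall>\<^sub>F N in sequentially. (\<Sum>n. w (n + N)) < \<eta> / 4"
    using \<eta> by (intro order_tendstoD(2)) auto
  then obtain N where N: "(\<Sum>n. w (n + N)) < \<eta> / 4"
    by (auto simp: eventually_sequentially)
  have "\<exists>\<delta>>0. \<forall>n<K. \<forall>h\<in>Y. norm h < \<delta> \<longrightarrow> \<phi> n (z + h) \<le> \<phi> n z + g n h + \<eta>' * norm h" for K
  proof (induction K)
    case 0
    then show ?case by (auto intro: exI[of _ 1])
  next
    case (Suc K)
    then obtain \<delta> where d1: "\<delta> > 0" "\<forall>n<K. \<forall>h\<in>Y. norm h < \<delta> \<longrightarrow> \<phi> n (z + h) \<le> \<phi> n z + g n h + \<eta>' * norm h"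
      by blast
    obtain \<delta>' where d2: "\<delta>' > 0" "\<forall>h\<in>Y. norm h < \<delta>' \<longrightarrow> \<phi> K (z + h) \<le> \<phi> K z + g K h + \<eta>' * norm h"
      using ug[OF \<eta>'] by blast
    show ?case
      using d1 d2 by (intro exI[of _ "min \<delta> \<delta>'"]) (auto simp: less_Suc_eq)
  qed
  from this[of N] obtain \<delta> where \<delta>: "\<delta> > 0"
    and near: "\<forall>n<N. \<forall>h\<in>Y. norm h < \<delta> \<longrightarrow> \<phi> n (z + h) \<le> \<phi> n z + g n h + \<eta>' * norm h"
    by blast
  define e where "e n = (if n < N then \<eta>' else 2)" for n
  have sw: "summable (\<lambda>n. w n * e n)"
    by (rule summable_comparison_test'[where N = 0 and g = "\<lambda>n. w n * max \<eta>' 2"])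
      (use w \<eta>' in \<open>auto simp: e_def abs_mult intro!: summable_mult2 mult_left_mono\<close>)
  have e_sum: "(\<Sum>n. w n * e n) \<le> \<eta>"
  proof -
    have "(\<Sum>n. w n * e n) = (\<Sum>n. w (n + N) * e (n + N)) + (\<Sum>n<N. w n * e n)"
      by (rule suminf_split_initial_segment[OF sw])
    also have "(\<Sum>n. w (n + N) * e (n + N)) = (\<Sum>n. w (n + N)) * 2"
      unfolding e_def using summable_ignore_initial_segment[OF w(2)] by (simp add: suminf_mult2)
    also have "(\<Sum>n<N. w n * e n) = (\<Sum>n<N. w n) * \<eta>'"
      by (simp add: e_def sum_distrib_right)
    also have "\<dots> \<le> W * \<eta>'"
      unfolding W_def using \<eta>' w by (intro mult_right_mono sum_le_suminf) auto
    also have "\<dots> \<le> \<eta> / 2"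
      using W \<eta> by (simp add: \<eta>'_def field_simps)
    finally show ?thesis using N by linarith
  qed
  have sg: "summable (\<lambda>n. w n * g n h)" for h
    by (rule summable_comparison_test'[where N = 0 and g = "\<lambda>n. w n * norm h"])
      (use w dual_ballD(4)[OF g] in \<open>auto simp: abs_mult intro!: summable_mult2 mult_left_mono\<close>)
  show ?thesis
  proof (intro exI[of _ \<delta>] conjI ballI impI)
    fix h assume h: "h \<in> Y" "norm h < \<delta>"
    have bound: "w n * \<phi> n (z + h) \<le> w n * \<phi> n z + w n * g n h + w n * e n * norm h" for n
    proof -
      have "\<phi> n (z + h) \<le> \<phi> n z + g n h + e n * norm h"
      proof (cases "n < N")
        case True
        then show ?thesis using near h by (simp add: e_def)
      next
        case False
        have "\<phi> n (z + h) \<le> \<phi> n z + norm h" using lip[of n "z + h" z] by simp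
        then show ?thesis using False dual_ballD(3)[OF g, of n h] by (simp add: e_def)
      qed
      from mult_left_mono[OF this w(1)[of n]] show ?thesis by (simp add: algebra_simps)
    qed
    have "(\<Sum>n. w n * \<phi> n (z + h)) \<le> (\<Sum>n. w n * \<phi> n z + w n * g n h + w n * e n * norm h)"
      by (rule suminf_le[OF bound sm]) (intro summable_add sm sg summable_mult2 sw)
    also have "\<dots> = (\<Sum>n. w n * \<phi> n z) + (\<Sum>n. w n * g n h) + (\<Sum>n. w n * e n) * norm h"
      unfolding suminf_add[OF summable_add[OF sm sg] summable_mult2[OF sw], symmetric]
        suminf_add[OF sm sg, symmetric] suminf_mult2[OF sw] ..
    also have "(\<Sum>n. w n * e n) * norm h \<le> \<eta> * norm h"
      by (rule mult_right_mono[OF e_sum]) simp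
    finally show "(\<Sum>n. w n * \<phi> n (z + h)) \<le> (\<Sum>n. w n * \<phi> n z) + (\<Sum>n. w n * g n h) + \<eta> * norm h"
      by simp
  qed (rule \<delta>)
qed

text \<open>The points are chosen one after the other: \<open>u n\<close> minimizes the sum of the first \<open>n\<close> terms over \<open>S\<close> up to
an error \<open>\<beta> n\<close>. The next term \<open>w n * G n (z - u n)\<close>, almost \<open>w n\<close> times the distance to \<open>u n\<close>,
then keeps all good competitors within \<open>\<theta> n + 2 * (1/2) ^ n\<close> of \<open>u n\<close>. This is the principle
of Borwein and Preiss, with penalties that agree with the distance only up to \<open>\<theta> n\<close>. The first term is
centred at \<open>0\<close>, so that the function to be minimized is the first term plus perturbations.\<close>
lemma variational_principle:
  fixes S :: "'a::banach set" and G :: "nat \<Rightarrow> 'a \<Rightarrow> real"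
  assumes S: "closed S" "S \<noteq> {}"
    and w: "\<And>n. 0 < w n" "summable w" "decseq w"
    and \<theta>: "\<And>n. 0 \<le> \<theta> n" "summable \<theta>"
    and G: "\<And>n z. G n z \<le> norm z" "\<And>n z. norm z - \<theta> n \<le> G n z" "\<And>n y z. G n y - G n z \<le> norm (y - z)"
  obtains u x where "u 0 = 0" "x \<in> S" "\<And>z. summable (\<lambda>n. w n * G n (z - u n))"
    "\<And>y. y \<in> S \<Longrightarrow> (\<Sum>n. w n * G n (x - u n)) \<le> (\<Sum>n. w n * G n (y - u n))"
proof -
  define \<beta> where "\<beta> n = w n * (1/2) ^ n" for n
  have \<beta>: "\<beta> n > 0" for n using w(1) by (simp add: \<beta>_def)
  define good where "good f n v \<longleftrightarrow> v \<in> S \<and> (\<forall>y\<in>S. f v \<le> f y + \<beta> n)" for f n v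
  define upd where "upd f n v = (\<lambda>z. f z + w n * G n (z - v))" for f n v
  \<comment> \<open>The recursion carries the partial sum along with the last point.\<close>
  define st where "st = rec_nat (\<lambda>_. 0, 0)
    (\<lambda>n (f, v). (upd f n v, SOME v'. good (upd f n v) (Suc n) v'))"
  define u where "u n = snd (st n)" for n
  define F where "F n z = (\<Sum>i<n. w i * G i (z - u i))" for n z
  have u0: "u 0 = 0" by (simp add: u_def st_def)
  have st_Suc: "st (Suc n) = (upd (fst (st n)) n (u n), SOME v'. good (upd (fst (st n)) n (u n)) (Suc n) v')" for n
    by (simp add: st_def u_def case_prod_beta)
  have fst_st: "fst (st n) = F n" for n
  proof (induction n)
    case 0
    then show ?case by (simp add: st_def F_def)
  next
    case (Suc n)
    then show ?case by (simp add: st_Suc upd_def F_def fun_eq_iff)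
  qed
  have F_Suc: "upd (F n) n (u n) = F (Suc n)" for n
    by (simp add: upd_def F_def fun_eq_iff)
  have "\<exists>v. good (F n) n v" for n
  proof -
    have "- (\<Sum>i<n. w i * \<theta> i) \<le> F n z" for z
      unfolding F_def sum_negf[symmetric]
    proof (rule sum_mono)
      fix i
      have "- \<theta> i \<le> G i (z - u i)" using G(2)[of "z - u i" i] norm_ge_zero[of "z - u i"] by linarith
      then have "w i * - \<theta> i \<le> w i * G i (z - u i)" using w(1)[of i] by (intro mult_left_mono) auto
      then show "- (w i * \<theta> i) \<le> w i * G i (z - u i)" by simp
    qed
    then have bdd: "bdd_below (F n ` S)" by (intro bdd_belowI2)
    obtain v where v: "v \<in> S" "F n v < (INF y\<in>S. F n y) + \<beta> n"
      using cINF_less_iff[OF S(2) bdd, of "(INF y\<in>S. F n y) + \<beta> n"] \<beta>[of n] by auto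
    have "F n v \<le> F n y + \<beta> n" if "y \<in> S" for y
      using cINF_lower[OF bdd that] v(2) by linarith
    then show ?thesis using v(1) by (auto simp: good_def)
  qed
  then have good: "good (F (Suc n)) (Suc n) (u (Suc n))" for n
    using st_Suc[of n] unfolding u_def[of "Suc n"] fst_st F_Suc by (simp add: someI_ex)
  have step: "norm (u (Suc (Suc n)) - u (Suc n)) \<le> \<theta> (Suc n) + 2 * (1/2) ^ Suc n" for n
  proof -
    let ?m = "Suc n" let ?r = "norm (u (Suc ?m) - u ?m)"
    have "F (Suc ?m) (u (Suc ?m)) \<le> F (Suc ?m) (u ?m) + \<beta> (Suc ?m)"
      using good[of ?m] good[of n] by (auto simp: good_def)
    moreover have "F ?m (u ?m) \<le> F ?m (u (Suc ?m)) + \<beta> ?m"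
      using good[of ?m] good[of n] by (auto simp: good_def)
    moreover have "F (Suc ?m) z = F ?m z + w ?m * G ?m (z - u ?m)" for z
      by (simp add: F_def)
    ultimately have "w ?m * G ?m (u (Suc ?m) - u ?m) \<le> w ?m * G ?m 0 + \<beta> ?m + \<beta> (Suc ?m)"
      by simp
    moreover have "w ?m * G ?m 0 \<le> 0"
      using G(1)[of ?m 0] w(1)[of ?m] by (simp add: mult_nonneg_nonpos)
    moreover have "w ?m * (?r - \<theta> ?m) \<le> w ?m * G ?m (u (Suc ?m) - u ?m)"
      using G(2) w(1)[of ?m] by (intro mult_left_mono) auto
    moreover have "\<beta> (Suc ?m) \<le> w ?m * (1/2) ^ ?m"
      unfolding \<beta>_def using decseqD[OF w(3), of ?m "Suc ?m"] w(1)
      by (intro mult_mono) (auto intro: less_imp_le)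
    moreover have "\<beta> ?m = w ?m * (1/2) ^ ?m" by (rule \<beta>_def)
    ultimately have "w ?m * (?r - \<theta> ?m) \<le> w ?m * (1/2) ^ ?m + w ?m * (1/2) ^ ?m"
      by linarith
    also have "\<dots> = w ?m * (2 * (1/2) ^ ?m)" by simp
    finally show ?thesis using w(1)[of ?m] by simp
  qed
  have "summable (\<lambda>n. u (Suc (Suc n)) - u (Suc n))"
    by (rule summable_comparison_test'[where N = 0 and g = "\<lambda>n. \<theta> (Suc n) + 2 * (1/2) ^ Suc n"])
      (use step \<theta>(2) in \<open>auto intro!: summable_add summable_mult sums_summable[OF power_half_series]
        simp: summable_Suc_iff simp del: power_Suc\<close>)
  then have "convergent (\<lambda>n. \<Sum>i<n. u (Suc (Suc i)) - u (Suc i))"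
    by (simp add: summable_iff_convergent)
  moreover have "(\<Sum>i<n. u (Suc (Suc i)) - u (Suc i)) = u (Suc n) - u (Suc 0)" for n
    using sum_lessThan_telescope[of "\<lambda>i. u (Suc i)" n] by simp
  ultimately obtain l where "(\<lambda>n. u (Suc n) - u (Suc 0)) \<longlonglongrightarrow> l"
    by (auto simp: convergent_def)
  from tendsto_add[OF this tendsto_const[of "u (Suc 0)"]]
  obtain x where ux: "(\<lambda>n. u (Suc n)) \<longlonglongrightarrow> x" by auto
  have xS: "x \<in> S"
    using closed_sequentially[OF S(1) _ ux] good by (auto simp: good_def)
  have "Bseq u" using ux convergentI convergent_imp_Bseq LIMSEQ_imp_Suc by blast
  then obtain B where B: "\<And>n. norm (u n) \<le> B" by (auto simp: Bseq_def)
  have "Bseq \<theta>" using summable_LIMSEQ_zero[OF \<theta>(2)] convergentI convergent_imp_Bseq by blast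
  then obtain T where "\<And>n. norm (\<theta> n) \<le> T" by (auto simp: Bseq_def)
  then have T: "\<theta> n \<le> T" for n by (metis abs_le_D1 real_norm_def)
  have sm: "summable (\<lambda>n. w n * G n (z - u n))" for z
  proof (rule summable_comparison_test'[where N = 0 and g = "\<lambda>n. w n * (norm z + B + T)"])
    show "summable (\<lambda>n. w n * (norm z + B + T))" by (rule summable_mult2[OF w(2)])
    fix n
    have "\<bar>G n (z - u n)\<bar> \<le> norm z + B + T"
      using G(1)[of n "z - u n"] G(2)[of "z - u n" n] norm_triangle_ineq4[of z "u n"] B[of n] T[of n] \<theta>(1)[of n]
        norm_ge_zero[of z] norm_ge_zero[of "u n"] norm_ge_zero[of "z - u n"]
      unfolding abs_le_iff by linarith
    then show "norm (w n * G n (z - u n)) \<le> w n * (norm z + B + T)"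
      using w(1)[of n] by (simp add: abs_mult mult_left_mono)
  qed
  define W where "W = suminf w"
  have min: "(\<Sum>n. w n * G n (x - u n)) \<le> (\<Sum>n. w n * G n (y - u n))" if y: "y \<in> S" for y
  proof (rule LIMSEQ_le)
    show "(\<lambda>n. F (Suc n) x) \<longlonglongrightarrow> (\<Sum>n. w n * G n (x - u n))"
      unfolding F_def by (rule LIMSEQ_Suc[OF summable_LIMSEQ[OF sm]])
    have "(\<lambda>n. \<beta> (Suc n)) \<longlonglongrightarrow> 0"
    proof -
      have "(\<lambda>n. w n * (1/2) ^ n) \<longlonglongrightarrow> 0 * 0"
        by (intro tendsto_mult summable_LIMSEQ_zero[OF w(2)] LIMSEQ_realpow_zero) auto
      from LIMSEQ_Suc[OF this] show ?thesis by (simp add: \<beta>_def)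
    qed
    moreover have "(\<lambda>n. F (Suc n) y) \<longlonglongrightarrow> (\<Sum>n. w n * G n (y - u n))"
      unfolding F_def by (rule LIMSEQ_Suc[OF summable_LIMSEQ[OF sm]])
    moreover have "(\<lambda>n. norm (x - u (Suc n))) \<longlonglongrightarrow> norm (x - x)"
      by (intro tendsto_intros ux)
    ultimately have "(\<lambda>n. F (Suc n) y + \<beta> (Suc n) + W * norm (x - u (Suc n)))
        \<longlonglongrightarrow> (\<Sum>n. w n * G n (y - u n)) + 0 + W * norm (x - x)"
      by (intro tendsto_intros ux)
    then show "(\<lambda>n. F (Suc n) y + \<beta> (Suc n) + W * norm (x - u (Suc n)))
        \<longlonglongrightarrow> (\<Sum>n. w n * G n (y - u n))" by simp
    have "F (Suc n) x \<le> F (Suc n) y + \<beta> (Suc n) + W * norm (x - u (Suc n))" for n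
    proof -
      let ?v = "u (Suc n)"
      have "F (Suc n) x - F (Suc n) ?v = (\<Sum>i<Suc n. w i * (G i (x - u i) - G i (?v - u i)))"
        by (simp add: F_def sum_subtractf algebra_simps)
      also have "\<dots> \<le> (\<Sum>i<Suc n. w i * norm (x - ?v))"
      proof (rule sum_mono)
        fix i
        have "G i (x - u i) - G i (?v - u i) \<le> norm (x - ?v)"
          using G(3)[of i "x - u i" "?v - u i"] by simp
        then show "w i * (G i (x - u i) - G i (?v - u i)) \<le> w i * norm (x - ?v)"
          using w(1)[of i] by (intro mult_left_mono) auto
      qed
      also have "\<dots> = (\<Sum>i<Suc n. w i) * norm (x - ?v)" by (simp only: sum_distrib_right)
      also have "\<dots> \<le> W * norm (x - ?v)"
        unfolding W_def by (intro mult_right_mono sum_le_suminf w(2)) (use w(1) in \<open>auto intro: less_imp_le\<close>)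
      finally show ?thesis using good[of n] y by (force simp: good_def)
    qed
    then show "\<exists>N. \<forall>n\<ge>N. F (Suc n) x \<le> F (Suc n) y + \<beta> (Suc n) + W * norm (x - u (Suc n))" by blast
  qed
  show thesis by (rule that[OF u0 xS sm min])
qed

section \<open>Separable reduction\<close>

lemma countable_closed_set:
  fixes \<Phi> :: "'a list \<Rightarrow> 'a set"
  assumes \<Phi>: "\<And>xs. countable (\<Phi> xs)" and Q0: "countable Q0"
  obtains Q where "countable Q" "Q0 \<subseteq> Q" "\<And>xs. set xs \<subseteq> Q \<Longrightarrow> \<Phi> xs \<subseteq> Q"
proof -
  define L where "L = rec_nat Q0 (\<lambda>_ Q. Q \<union> (\<Union>xs\<in>lists Q. \<Phi> xs))"
  have L0: "L 0 = Q0" and LS: "L (Suc n) = L n \<union> (\<Union>xs\<in>lists (L n). \<Phi> xs)" for n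
    by (simp_all add: L_def)
  have cL: "countable (L n)" for n
    by (induction n) (auto simp: L0 LS Q0 \<Phi> simp del: lists_UNIV)
  have mono: "L m \<subseteq> L n" if "m \<le> n" for m n
    using that by (rule lift_Suc_mono_le[rotated]) (auto simp: LS)
  have closed: "\<Phi> xs \<subseteq> (\<Union>n. L n)" if xs: "set xs \<subseteq> (\<Union>n. L n)" for xs
  proof -
    have "\<exists>n. set xs \<subseteq> L n"
      using xs
    proof (induction xs)
      case Nil
      then show ?case by simp
    next
      case (Cons a xs)
      then obtain m n where mn: "a \<in> L m" "set xs \<subseteq> L n" by auto
      then have "set (a # xs) \<subseteq> L (max m n)"
        using mono[of m "max m n"] mono[of n "max m n"] by auto
      then show ?case by blast
    qed
    then obtain n where "set xs \<subseteq> L n" by blast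
    then have "\<Phi> xs \<subseteq> L (Suc n)" by (auto simp: LS)
    then show ?thesis by blast
  qed
  show thesis
    by (rule that[of "\<Union>n. L n"]) (use cL L0 closed in auto)
qed

lemma subspace_closure_rational:
  fixes Q :: "'a::real_normed_vector set"
  assumes zero: "0 \<in> Q" and add: "\<And>x y. x \<in> Q \<Longrightarrow> y \<in> Q \<Longrightarrow> x + y \<in> Q"
    and scale: "\<And>r x. r \<in> \<rat> \<Longrightarrow> x \<in> Q \<Longrightarrow> r *\<^sub>R x \<in> Q"
  shows "subspace (closure Q)"
  unfolding subspace_def
proof (intro conjI ballI allI)
  show "0 \<in> closure Q" using zero closure_subset by blast
next
  have *: "(\<lambda>x. x + y) ` closure Q \<subseteq> closure Q" if "y \<in> Q" for y
    by (rule image_closure_subset)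
      (use add[OF _ that] closure_subset in \<open>auto intro!: continuous_intros\<close>)
  have "(\<lambda>y. x + y) ` closure Q \<subseteq> closure Q" if "x \<in> closure Q" for x
    by (rule image_closure_subset) (use * that in \<open>auto intro!: continuous_intros\<close>)
  then show "x + y \<in> closure Q" if "x \<in> closure Q" "y \<in> closure Q" for x y
    using that by blast
next
  have *: "(\<lambda>x. r *\<^sub>R x) ` closure Q \<subseteq> closure Q" if "r \<in> \<rat>" for r
    by (rule image_closure_subset)
      (use scale[OF that] closure_subset in \<open>auto intro!: continuous_intros\<close>)
  have "(\<lambda>c. c *\<^sub>R x) ` closure \<rat> \<subseteq> closure Q" if "x \<in> closure Q" for x
    by (rule image_closure_subset) (use * that in \<open>auto intro!: continuous_intros\<close>)
  then show "c *\<^sub>R x \<in> closure Q" if "x \<in> closure Q" for c x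
    using that by (auto simp: Rats_closure_real)
qed

text \<open>Membership in the Frechet normal cone, for functionals represented as plain functions.\<close>
definition frechet_bound :: "'a::real_normed_vector set \<Rightarrow> 'a \<Rightarrow> ('a \<Rightarrow> real) \<Rightarrow> bool" where
  "frechet_bound C x f \<longleftrightarrow>
    (\<forall>\<eta>>0. \<exists>\<delta>>0. \<forall>c\<in>C. norm (c - x) < \<delta> \<longrightarrow> f (c - x) \<le> \<eta> * norm (c - x))"

text \<open>A finite certificate for the absence of a normal at \<open>x\<close> in the dual ball that is at least \<open>1\<close> at \<open>v\<close>:
finitely many points \<open>c\<close> of \<open>C\<close>, each within a prescribed radius of \<open>x\<close>, whose constraints cannot
be met even approximately. The pair \<open>(k, N)\<close> encodes the slope \<open>1 / (k + 1)\<close> and the radius \<open>1 / (N + 1)\<close>,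
and \<open>1 / (M + 1)\<close> is the tolerance. The slopes, radii and tolerance range over a countable set.\<close>
definition obstruction ::
  "'a::real_normed_vector set \<Rightarrow> 'a \<Rightarrow> 'a \<Rightarrow> nat \<Rightarrow> ((nat \<times> nat) \<times> 'a) list \<Rightarrow> bool" where
  "obstruction C x v M zs \<longleftrightarrow>
    (\<forall>((k, N), c)\<in>set zs. c \<in> C \<and> norm (c - x) < 1 / real (Suc N)) \<and>
    \<not> (\<exists>q\<in>dual_ball. 1 - 1 / real (Suc M) \<le> q v \<and>
        (\<forall>((k, N), c)\<in>set zs. q (c - x) \<le> 1 / real (Suc k) * norm (c - x) + 1 / real (Suc M)))"

text \<open>By weak-star compactness, a normal exists at \<open>x\<close> as soon as all finite sets of relaxed constraints can be
met. A finite set of constraints that fails is an obstruction, and since it fails with room to spare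
it persists when \<open>x\<close> and \<open>v\<close> are replaced by nearby points of \<open>Q\<close>. The set \<open>Q\<close> is closed under a
choice of obstructions, so the points of \<open>C\<close> in the obstruction can be taken in \<open>Q\<close>; there it
contradicts the functional \<open>f\<close>, which satisfies all constraints that come from \<open>C \<inter> closure Q\<close>. Only
countably many choices are involved because \<open>x\<close> and \<open>v\<close> themselves need not belong to \<open>Q\<close>.\<close>
lemma separable_reduction:
  fixes C :: "'a::real_normed_vector set"
  assumes "countable Q0"
  obtains Q where "countable Q" "Q0 \<subseteq> Q" "subspace (closure Q)"
    "\<And>x v f. x \<in> C \<Longrightarrow> x \<in> closure Q \<Longrightarrow> v \<in> closure Q \<Longrightarrow> f \<in> dual_ball \<Longrightarrow> 1 \<le> f v
      \<Longrightarrow> frechet_bound (C \<inter> closure Q) x f \<Longrightarrow> \<exists>p\<in>dual_ball. 1 \<le> p v \<and> frechet_bound C x p"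
proof -
  define sel where "sel ks M x v = (SOME zs. map fst zs = ks \<and> obstruction C x v M zs)" for ks M x v
  define \<Phi> where "\<Phi> xs = {0, xs ! 0 + xs ! 1} \<union> (\<lambda>r. r *\<^sub>R hd xs) ` \<rat>
      \<union> (\<Union>i. snd ` set (sel (fst i) (snd i) (xs ! 0) (xs ! 1)))" for xs
  have c\<Phi>: "countable (\<Phi> xs)" for xs
    unfolding \<Phi>_def by (intro countable_Un countable_UN countable_image countable_rat)
      (auto simp: countable_finite)
  obtain Q where Q: "countable Q" "Q0 \<subseteq> Q" and closed: "\<And>xs. set xs \<subseteq> Q \<Longrightarrow> \<Phi> xs \<subseteq> Q"
    by (rule countable_closed_set[OF c\<Phi> assms]) (rule that)
  have zero: "0 \<in> Q" using closed[of "[]"] by (auto simp: \<Phi>_def)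
  have Qsel: "snd ` set (sel ks M x v) \<subseteq> Q" if "x \<in> Q" "v \<in> Q" for ks M x v
  proof -
    have "snd ` set (sel ks M x v) \<subseteq> \<Phi> [x, v]"
      using UN_upper[of "(ks, M)" UNIV "\<lambda>i. snd ` set (sel (fst i) (snd i) x v)"]
      by (simp add: \<Phi>_def) blast
    then show ?thesis using closed[of "[x, v]"] that by simp
  qed
  have sub: "subspace (closure Q)"
  proof (rule subspace_closure_rational[OF zero])
    show "x + y \<in> Q" if "x \<in> Q" "y \<in> Q" for x y
      using closed[of "[x, y]"] that by (auto simp: \<Phi>_def)
    show "r *\<^sub>R x \<in> Q" if "r \<in> \<rat>" "x \<in> Q" for r x
      using closed[of "[x]"] that by (auto simp: \<Phi>_def)
  qed
  have main: "\<exists>p\<in>dual_ball. 1 \<le> p v \<and> frechet_bound C x p"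
    if xC: "x \<in> C" and x: "x \<in> closure Q" and v: "v \<in> closure Q" and f: "f \<in> dual_ball" "1 \<le> f v"
      and fb: "frechet_bound (C \<inter> closure Q) x f" for x v f
  proof -
    have "\<exists>N. \<forall>c\<in>C \<inter> closure Q. norm (c - x) < 2 / real (Suc N)
        \<longrightarrow> f (c - x) \<le> 1 / real (Suc k) * norm (c - x)" for k
    proof -
      obtain \<delta> where \<delta>: "\<delta> > 0" "\<forall>c\<in>C \<inter> closure Q. norm (c - x) < \<delta>
          \<longrightarrow> f (c - x) \<le> 1 / real (Suc k) * norm (c - x)"
        using fb unfolding frechet_bound_def by (metis of_nat_0_less_iff zero_less_Suc zero_less_divide_1_iff)
      obtain N where "inverse (real (Suc N)) < \<delta> / 2"
        using reals_Archimedean[of "\<delta> / 2"] \<delta>(1) by auto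
      then have "2 / real (Suc N) < \<delta>" by (simp add: field_simps)
      then show ?thesis using \<delta>(2) by (intro exI[of _ N]) (auto intro: less_trans)
    qed
    then obtain N where N: "\<And>k c. c \<in> C \<Longrightarrow> c \<in> closure Q \<Longrightarrow> norm (c - x) < 2 / real (Suc (N k))
        \<Longrightarrow> f (c - x) \<le> 1 / real (Suc k) * norm (c - x)"
      by (metis Int_iff)
    define I where "I = {(k, c, s::nat). c \<in> C \<and> norm (c - x) < 1 / (2 * real (Suc (N k)))}"
    define T where "T = (\<lambda>(k, c, s). {q. 1 - 1 / real (Suc s) \<le> q v \<and>
        q (c - x) \<le> 1 / real (Suc k) * norm (c - x) + 1 / real (Suc s)})"
    have ev: "continuous_on UNIV (\<lambda>f::'a \<Rightarrow> real. f y)" for y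
      by (rule continuous_on_product_coordinates)
    have "dual_ball \<inter> (\<Inter>i\<in>I. T i) \<noteq> {}"
    proof (rule compact_imp_fip_image[OF compact_dual_ball])
      fix i :: "nat \<times> 'a \<times> nat"
      show "closed (T i)"
        unfolding T_def
        by (cases i) (auto intro!: closed_Collect_conj closed_Collect_le continuous_intros ev)
    next
      fix I' assume I': "finite I'" "I' \<subseteq> I"
      then obtain js where js: "set js = I'" using finite_list by blast
      define s0 where "s0 = Max (insert 0 ((\<lambda>(k, c, s). s) ` I'))"
      have s0: "s \<le> s0" if "(k, c, s) \<in> I'" for k c s
        unfolding s0_def using I'(1) that by (intro Max_ge) (auto intro: rev_image_eqI)
      \<comment> \<open>The tolerance \<open>e\<close> of the obstruction is a quarter of the smallest tolerance asked for; the other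
        quarters absorb the passage between \<open>(x, v)\<close> and \<open>(x', v')\<close>.\<close>
      define M where "M = 4 * s0 + 3"
      define e where "e = 1 / real (Suc M)"
      have e: "e > 0" by (simp add: e_def)
      have e4: "4 * e = 1 / real (Suc s0)" by (simp add: e_def M_def field_simps)
      define zs where "zs = map (\<lambda>(k, c, s). ((k, N k), c)) js"
      have "\<exists>q\<in>dual_ball. 1 - 4 * e \<le> q v \<and>
          (\<forall>((k, n), c)\<in>set zs. q (c - x) \<le> 1 / real (Suc k) * norm (c - x) + 4 * e)"
      proof (rule ccontr)
        assume no: "\<not> ?thesis"
        define \<tau> where "\<tau> = Min (insert (e / 2) ((\<lambda>((k, n), c). 1 / (2 * real (Suc n))) ` set zs))"
        have \<tau>: "\<tau> > 0" "\<tau> \<le> e / 2" "\<And>k n c. ((k, n), c) \<in> set zs \<Longrightarrow> \<tau> \<le> 1 / (2 * real (Suc n))"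
        proof -
          show "\<tau> > 0" unfolding \<tau>_def using e by (subst Min_gr_iff) auto
          show "\<tau> \<le> e / 2" unfolding \<tau>_def by (rule Min_le) auto
          show "\<tau> \<le> 1 / (2 * real (Suc n))" if "((k, n), c) \<in> set zs" for k n c
            unfolding \<tau>_def by (rule Min_le) (use that in \<open>auto intro: rev_image_eqI\<close>)
        qed
        obtain x' where x': "x' \<in> Q" "norm (x' - x) < \<tau>"
          using x \<tau>(1) unfolding closure_approachable dist_norm by blast
        obtain v' where v': "v' \<in> Q" "norm (v' - v) < \<tau>"
          using v \<tau>(1) unfolding closure_approachable dist_norm by blast
        have shift: "\<bar>norm (c - x') - norm (c - x)\<bar> < \<tau>" for c
          using norm_triangle_ineq3[of "c - x'" "c - x"] x'(2) by (simp add: norm_minus_commute)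
        have shift': "norm (c - x') < norm (c - x) + \<tau>" "norm (c - x) < norm (c - x') + \<tau>" for c
          using shift[of c] by linarith+
        have halves: "1 / (2 * real (Suc n)) + 1 / (2 * real (Suc n)) = 1 / real (Suc n)"
          "2 / real (Suc n) = 1 / real (Suc n) + 1 / real (Suc n)" for n
          by (simp_all add: field_simps)
        have qshift: "\<bar>q (c - x') - q (c - x)\<bar> < \<tau>" "\<bar>q v' - q v\<bar> < \<tau>" if "q \<in> dual_ball" for q c
          using dual_ballD(5)[OF that, of "c - x'" "c - x"] dual_ballD(5)[OF that, of v' v] x'(2) v'(2)
          by (simp_all add: norm_minus_commute)
        have kshift: "1 / real (Suc k) * norm (c - x') \<le> 1 / real (Suc k) * norm (c - x) + \<tau>"
          "1 / real (Suc k) * norm (c - x) \<le> 1 / real (Suc k) * norm (c - x') + \<tau>" for k c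
        proof -
          have "\<tau> / real (Suc k) \<le> \<tau>" using \<tau>(1) by (simp add: field_simps)
          moreover have "1 / real (Suc k) * norm (c - x') \<le> 1 / real (Suc k) * (norm (c - x) + \<tau>)"
            "1 / real (Suc k) * norm (c - x) \<le> 1 / real (Suc k) * (norm (c - x') + \<tau>)"
            using shift[of c] by (intro mult_left_mono; simp)+
          ultimately show "1 / real (Suc k) * norm (c - x') \<le> 1 / real (Suc k) * norm (c - x) + \<tau>"
            "1 / real (Suc k) * norm (c - x) \<le> 1 / real (Suc k) * norm (c - x') + \<tau>"
            by (simp_all add: add_divide_distrib)
        qed
        have "obstruction C x' v' M zs"
          unfolding obstruction_def e_def[symmetric]
        proof (intro conjI notI)
          show "\<forall>((k, n), c)\<in>set zs. c \<in> C \<and> norm (c - x') < 1 / real (Suc n)"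
          proof (clarify, rule conjI)
            fix k n c assume z: "((k, n), c) \<in> set zs"
            then have "c \<in> C" "norm (c - x) < 1 / (2 * real (Suc n))"
              using I'(2) js by (auto simp: zs_def I_def)
            then show "c \<in> C" "norm (c - x') < 1 / real (Suc n)"
              using shift'(1)[of c] \<tau>(3)[OF z] halves(1)[of n] by argo+
          qed
        next
          assume "\<exists>q\<in>dual_ball. 1 - e \<le> q v' \<and>
            (\<forall>((k, n), c)\<in>set zs. q (c - x') \<le> 1 / real (Suc k) * norm (c - x') + e)"
          then obtain q where q: "q \<in> dual_ball" "1 - e \<le> q v'"
            and qz: "\<forall>((k, n), c)\<in>set zs. q (c - x') \<le> 1 / real (Suc k) * norm (c - x') + e"
            by blast
          have "1 - 4 * e \<le> q v" using q(2) qshift(2)[OF q(1)] \<tau>(2) e by linarith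
          moreover have "q (c - x) \<le> 1 / real (Suc k) * norm (c - x) + 4 * e"
            if "((k, n), c) \<in> set zs" for k n c
            using bspec[OF qz that, simplified prod.case] qshift(1)[OF q(1), of c] kshift(1)[of k c] \<tau>(2) e by linarith
          ultimately show False using no q(1) by fast
        qed
        then have "\<exists>ws. map fst ws = map fst zs \<and> obstruction C x' v' M ws" by blast
        then have ws: "map fst (sel (map fst zs) M x' v') = map fst zs"
          "obstruction C x' v' M (sel (map fst zs) M x' v')" (is "obstruction _ _ _ _ ?ws")
          unfolding sel_def by (metis (mono_tags, lifting) someI_ex)+
        have "1 - e \<le> f v'" using f(2) qshift(2)[OF f(1)] \<tau>(2) e by linarith
        moreover have "f (c - x') \<le> 1 / real (Suc k) * norm (c - x') + e"
          if z: "((k, n), c) \<in> set ?ws" for k n c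
        proof -
          have "(k, n) \<in> set (map fst ?ws)" using z by force
          then have "(k, n) \<in> set (map fst zs)" by (simp only: ws(1))
          then obtain c0 where c0: "((k, n), c0) \<in> set zs" by force
          then have n: "n = N k" by (auto simp: zs_def)
          have "c \<in> Q" using Qsel[OF x'(1) v'(1), of "map fst zs" M] z by force
          then have cQ: "c \<in> closure Q" using closure_subset by blast
          have "c \<in> C" "norm (c - x') < 1 / real (Suc n)"
            using ws(2) z unfolding obstruction_def by blast+
          moreover have "norm (c - x) < 2 / real (Suc n)"
            using shift'(2)[of c] \<tau>(1) \<tau>(3)[OF c0] \<open>norm (c - x') < 1 / real (Suc n)\<close> halves[of n]
            by argo
          ultimately have "f (c - x) \<le> 1 / real (Suc k) * norm (c - x)"
            using N[of c k] cQ n by simp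
          then show ?thesis using qshift(1)[OF f(1), of c] kshift(2)[of k c] \<tau>(2) by linarith
        qed
        ultimately show False
          using ws(2) f(1) unfolding obstruction_def e_def[symmetric] by fast
      qed
      then obtain q where q: "q \<in> dual_ball" "1 - 4 * e \<le> q v"
        and qz: "\<forall>((k, n), c)\<in>set zs. q (c - x) \<le> 1 / real (Suc k) * norm (c - x) + 4 * e"
        by blast
      have "q \<in> T i" if i: "i \<in> I'" for i
      proof -
        obtain k c s where kcs: "i = (k, c, s)" by (cases i)
        have "((k, N k), c) \<in> set zs" using i js kcs by (force simp: zs_def)
        then have "q (c - x) \<le> 1 / real (Suc k) * norm (c - x) + 4 * e" using qz by blast
        moreover have "4 * e \<le> 1 / real (Suc s)"
          unfolding e4 using s0 i kcs by (simp add: field_simps)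
        ultimately show ?thesis using q(2) by (simp add: T_def kcs)
      qed
      then show "dual_ball \<inter> (\<Inter>i\<in>I'. T i) \<noteq> {}" using q(1) by blast
    qed
    then obtain p where p: "p \<in> dual_ball" and pT: "\<And>i. i \<in> I \<Longrightarrow> p \<in> T i" by blast
    have lim: "a \<le> b" if "\<And>s. a \<le> b + 1 / real (Suc s)" for a b :: real
    proof (rule field_le_epsilon)
      fix e :: real assume "e > 0"
      then obtain s where "inverse (real (Suc s)) < e" using reals_Archimedean by blast
      then show "a \<le> b + e" using that[of s] by (simp add: inverse_eq_divide)
    qed
    have "1 \<le> p v"
    proof (rule lim)
      fix s
      have "(0, x, s) \<in> I" using xC by (simp add: I_def)
      from pT[OF this] show "1 \<le> p v + 1 / real (Suc s)" by (simp add: T_def)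
    qed
    moreover have "frechet_bound C x p"
      unfolding frechet_bound_def
    proof (intro allI impI)
      fix \<eta> :: real assume "\<eta> > 0"
      then obtain k where k: "inverse (real (Suc k)) < \<eta>" using reals_Archimedean by blast
      show "\<exists>\<delta>>0. \<forall>c\<in>C. norm (c - x) < \<delta> \<longrightarrow> p (c - x) \<le> \<eta> * norm (c - x)"
      proof (intro exI[of _ "1 / (2 * real (Suc (N k)))"] conjI ballI impI)
        fix c assume c: "c \<in> C" "norm (c - x) < 1 / (2 * real (Suc (N k)))"
        have "p (c - x) \<le> 1 / real (Suc k) * norm (c - x)"
        proof (rule lim)
          fix s
          have "(k, c, s) \<in> I" using c by (simp add: I_def)
          from pT[OF this] show "p (c - x) \<le> 1 / real (Suc k) * norm (c - x) + 1 / real (Suc s)"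
            by (simp add: T_def)
        qed
        also have "\<dots> \<le> \<eta> * norm (c - x)"
          using k by (intro mult_right_mono) (auto simp: inverse_eq_divide)
        finally show "p (c - x) \<le> \<eta> * norm (c - x)" .
      qed simp
    qed
    ultimately show ?thesis using p by blast
  qed
  show thesis by (rule that[OF Q sub main])
qed

section \<open>Normals of closed sets\<close>

text \<open>The weights are \<open>1\<close> for the smooth substitute of the norm and \<open>\<mu>\<close> in total for the perturbations. With \<open>P\<close> the
gradient of the whole sum at the minimum point \<open>x\<close>, minimality makes \<open>- P\<close> normal to the part of
\<open>C\<close> in \<open>Y\<close>. Here \<open>P x > 0\<close>, because the first gradient is almost \<open>norm x\<close> at \<open>x\<close>, which is
bounded away from \<open>0\<close>, and the perturbations contribute at most \<open>\<mu> * norm x\<close>. The factor \<open>1 / 2\<close>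
in \<open>f\<close> brings \<open>- P\<close> into the dual ball.\<close>
lemma closed_set_frechet_normal:
  fixes C :: "'a::banach set"
  assumes asp: "asplund_space TYPE('a)" and C: "closed C" "0 \<notin> C" and c0: "c0 \<in> C" and \<epsilon>: "\<epsilon> > 0"
  obtains x p v where "x \<in> C" "norm x < norm c0 + \<epsilon>" "p \<in> dual_ball" "1 \<le> p v" "frechet_bound C x p"
proof -
  obtain r where r: "r > 0" "\<And>c. c \<in> C \<Longrightarrow> r \<le> norm c"
  proof -
    have "\<not> (\<forall>e>0. \<exists>y\<in>C. dist y 0 < e)"
      using C closure_approachable[of 0 C] by (simp add: closure_closed)
    then show ?thesis using that by (auto simp: not_less)
  qed
  obtain Q where Q: "countable Q" "{c0} \<subseteq> Q" "subspace (closure Q)" and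
    reduction: "\<And>x v f. x \<in> C \<Longrightarrow> x \<in> closure Q \<Longrightarrow> v \<in> closure Q \<Longrightarrow> f \<in> dual_ball \<Longrightarrow> 1 \<le> f v
      \<Longrightarrow> frechet_bound (C \<inter> closure Q) x f \<Longrightarrow> \<exists>p\<in>dual_ball. 1 \<le> p v \<and> frechet_bound C x p"
    by (rule separable_reduction[of "{c0}" C]) (simp, rule that)
  define Y where "Y = closure Q"
  define S where "S = C \<inter> Y"
  have S: "closed S" "S \<noteq> {}" "c0 \<in> S" "S \<subseteq> Y"
    using C(1) c0 Q(2) closure_subset[of Q] by (auto simp: S_def Y_def)
  \<comment> \<open>The terms with \<open>\<epsilon>\<close> keep \<open>norm x\<close> below \<open>norm c0 + \<epsilon>\<close>; the terms \<open>1 / 2\<close> and \<open>r / 4\<close> make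
    \<open>P x\<close> at least \<open>norm x / 2 - r / 4\<close>, which is positive.\<close>
  define \<mu> where "\<mu> = min (1 / 2) (\<epsilon> / (4 * (2 * norm c0 + \<epsilon>)))"
  define \<kappa> where "\<kappa> = min (r / 4) (\<epsilon> / 4)"
  have pos: "2 * norm c0 + \<epsilon> > 0" using \<epsilon> by (intro add_nonneg_pos) auto
  have \<mu>: "\<mu> > 0" "\<mu> \<le> 1 / 2" using \<epsilon> pos by (auto simp: \<mu>_def)
  have "\<mu> \<le> \<epsilon> / 4 / (2 * norm c0 + \<epsilon>)" by (simp add: \<mu>_def)
  then have \<mu>_small: "\<mu> * (2 * norm c0 + \<epsilon>) \<le> \<epsilon> / 4"
    by (simp only: pos_le_divide_eq[OF pos])
  have \<kappa>: "\<kappa> > 0" "\<kappa> \<le> r / 4" "\<kappa> \<le> \<epsilon> / 4" using r(1) \<epsilon> by (auto simp: \<kappa>_def)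
  define w :: "nat \<Rightarrow> real" where "w n = (if n = 0 then 1 else \<mu> * (1/2) ^ n)" for n
  define \<theta> :: "nat \<Rightarrow> real" where "\<theta> n = \<kappa> * (1/2) ^ n" for n
  have w: "w n > 0" for n using \<mu> by (simp add: w_def)
  have w0: "w 0 = 1" by (simp add: w_def)
  have w_tail: "(\<lambda>n. w (Suc n)) sums \<mu>"
    using sums_mult[OF power_half_series, of \<mu>] by (simp add: w_def)
  then have sw: "summable w" using sums_summable summable_Suc_iff by blast
  have dec: "decseq w"
  proof (rule decseq_SucI)
    fix n show "w (Suc n) \<le> w n" using \<mu> by (simp add: w_def)
  qed
  have \<theta>: "\<theta> n > 0" for n using \<kappa> by (simp add: \<theta>_def)
  have s\<theta>: "summable \<theta>" unfolding \<theta>_def by (intro summable_mult summable_geometric) simp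
  have "\<exists>G. (\<forall>z. G z \<le> norm z) \<and> (\<forall>z. norm z - \<theta> n \<le> G z) \<and> (\<forall>z y. G z - G y \<le> norm (z - y)) \<and>
      (\<forall>z. \<exists>g\<in>dual_ball. G z \<le> g z \<and>
        (\<forall>\<eta>>0. \<exists>\<delta>>0. \<forall>h\<in>Y. norm h < \<delta> \<longrightarrow> G (z + h) \<le> G z + g h + \<eta> * norm h))" for n
    by (rule smooth_norm_approximation[OF asp Q(3,1) order_refl \<theta>[of n]]) (unfold Y_def, blast)
  then obtain G where G: "\<And>n z. G n z \<le> norm z" "\<And>n z. norm z - \<theta> n \<le> G n z"
      "\<And>n z y. G n z - G n y \<le> norm (z - y)"
    and G': "\<And>n z. \<exists>g\<in>dual_ball. G n z \<le> g z \<and>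
        (\<forall>\<eta>>0. \<exists>\<delta>>0. \<forall>h\<in>Y. norm h < \<delta> \<longrightarrow> G n (z + h) \<le> G n z + g h + \<eta> * norm h)"
    by metis
  obtain u x where u0: "u 0 = 0" and x: "x \<in> S" and sm: "\<And>z. summable (\<lambda>n. w n * G n (z - u n))"
    and min: "\<And>y. y \<in> S \<Longrightarrow> (\<Sum>n. w n * G n (x - u n)) \<le> (\<Sum>n. w n * G n (y - u n))"
    by (rule variational_principle[OF S(1,2) w sw dec less_imp_le[OF \<theta>] s\<theta> G]) (rule that)
  have xC: "x \<in> C" and xY: "x \<in> Y" using x by (auto simp: S_def)
  have near: "norm x < norm c0 + \<epsilon>"
  proof (rule ccontr)
    assume "\<not> ?thesis"
    then have big: "norm c0 + \<epsilon> \<le> norm x" by simp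
    have tail: "(\<Sum>n. w (Suc n) * G (Suc n) (z - u (Suc n))) = (\<Sum>n. w n * G n (z - u n)) - G 0 z" for z
      using suminf_split_head[OF sm[of z]] by (simp add: u0 w0)
    have sm': "summable (\<lambda>n. w (Suc n) * G (Suc n) (z - u (Suc n)))" for z
      using sm[of z] by (subst summable_Suc_iff)
    have "(\<Sum>n. w (Suc n) * G (Suc n) (c0 - u (Suc n)))
        \<le> (\<Sum>n. w (Suc n) * G (Suc n) (x - u (Suc n)) + w (Suc n) * norm (c0 - x))"
    proof (rule suminf_le)
      fix n
      have "G (Suc n) (c0 - u (Suc n)) \<le> G (Suc n) (x - u (Suc n)) + norm (c0 - x)"
        using G(3)[of "Suc n" "c0 - u (Suc n)" "x - u (Suc n)"] by simp
      from mult_left_mono[OF this less_imp_le[OF w]]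
      show "w (Suc n) * G (Suc n) (c0 - u (Suc n))
          \<le> w (Suc n) * G (Suc n) (x - u (Suc n)) + w (Suc n) * norm (c0 - x)"
        by (simp add: distrib_left)
    qed (intro sm' summable_add summable_mult2 sums_summable[OF w_tail])+
    also have "\<dots> = (\<Sum>n. w (Suc n) * G (Suc n) (x - u (Suc n))) + \<mu> * norm (c0 - x)"
      using suminf_add[OF sm'[of x] summable_mult2[OF sums_summable[OF w_tail], of "norm (c0 - x)"]]
        suminf_mult2[OF sums_summable[OF w_tail], of "norm (c0 - x)"] sums_unique[OF w_tail] by simp
    finally have "G 0 x \<le> G 0 c0 + \<mu> * norm (c0 - x)"
      using min[OF S(3)] unfolding tail by linarith
    moreover have "\<mu> * norm (c0 - x) \<le> \<mu> * (norm c0 + norm x)"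
      using \<mu>(1) by (intro mult_left_mono norm_triangle_ineq4) auto
    moreover have "norm x - \<kappa> \<le> G 0 x" using G(2)[of x 0] by (simp add: \<theta>_def)
    moreover have "G 0 c0 \<le> norm c0" by (rule G(1))
    ultimately have "(1 - \<mu>) * norm x \<le> (1 + \<mu>) * norm c0 + \<kappa>"
      by (simp add: algebra_simps)
    moreover have "(1 - \<mu>) * (norm c0 + \<epsilon>) \<le> (1 - \<mu>) * norm x"
      using big \<mu>(2) by (intro mult_left_mono) auto
    ultimately have "\<epsilon> \<le> \<mu> * (2 * norm c0 + \<epsilon>) + \<kappa>" by (simp add: algebra_simps)
    then show False using \<mu>_small \<kappa>(3) \<epsilon> by linarith
  qed
  define is_gradient where "is_gradient n g \<longleftrightarrow> g \<in> dual_ball \<and> G n (x - u n) \<le> g (x - u n) \<and>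
      (\<forall>\<eta>>0. \<exists>\<delta>>0. \<forall>h\<in>Y. norm h < \<delta> \<longrightarrow>
        G n ((x - u n) + h) \<le> G n (x - u n) + g h + \<eta> * norm h)" for n g
  have "\<exists>g. is_gradient n g" for n
    using G'[of n "x - u n"] unfolding is_gradient_def by blast
  then have "\<exists>g. \<forall>n. is_gradient n (g n)" by (intro choice allI)
  then obtain g where grad: "\<And>n. is_gradient n (g n)" by blast
  have g: "g n \<in> dual_ball" "G n (x - u n) \<le> g n (x - u n)" for n
    using grad[of n] by (auto simp: is_gradient_def)
  have ug: "\<exists>\<delta>>0. \<forall>h\<in>Y. norm h < \<delta> \<longrightarrow>
        G n ((x - u n) + h) \<le> G n (x - u n) + g n h + \<eta> * norm h" if "\<eta> > 0" for n \<eta>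
    using grad[of n] that by (simp add: is_gradient_def)
  define P where "P h = (\<Sum>n. w n * g n h)" for h
  have sg: "summable (\<lambda>n. w n * g n h)" for h
    by (rule summable_comparison_test'[where N = 0 and g = "\<lambda>n. w n * norm h"])
      (use less_imp_le[OF w] sw dual_ballD(4)[OF g(1)] in
        \<open>auto simp: abs_mult intro!: summable_mult2 mult_left_mono\<close>)
  have linP: "linear P"
  proof (rule linearI)
    show "P (y + z) = P y + P z" for y z
      unfolding P_def suminf_add[OF sg sg]
      by (simp add: linear_add[OF dual_ballD(1)[OF g(1)]] distrib_left)
    show "P (c *\<^sub>R y) = c *\<^sub>R P y" for c y
      using suminf_mult[OF sg[of y], of c]
      by (simp add: P_def linear_scale[OF dual_ballD(1)[OF g(1)]] mult_ac)
  qed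
  have P_split: "P h = g 0 h + (\<Sum>n. w (Suc n) * g (Suc n) h)" for h
    using suminf_split_head[OF sg[of h]] by (simp add: P_def w0)
  have P_tail: "\<bar>\<Sum>n. w (Suc n) * g (Suc n) h\<bar> \<le> \<mu> * norm h" for h
  proof -
    have "norm (\<Sum>n. w (Suc n) * g (Suc n) h) \<le> (\<Sum>n. w (Suc n) * norm h)"
    proof (rule norm_suminf_le)
      fix n
      show "norm (w (Suc n) * g (Suc n) h) \<le> w (Suc n) * norm h"
        using less_imp_le[OF w[of "Suc n"]] dual_ballD(4)[OF g(1), of "Suc n" h]
        by (auto simp: abs_mult intro: mult_left_mono)
    qed (intro summable_mult2 sums_summable[OF w_tail])
    then show ?thesis
      using suminf_mult2[OF sums_summable[OF w_tail], of "norm h"] sums_unique[OF w_tail] by simp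
  qed
  have P_le: "\<bar>P h\<bar> \<le> 2 * norm h" for h
  proof -
    have "\<mu> * norm h \<le> 1 * norm h" using \<mu>(2) by (intro mult_right_mono) auto
    then show ?thesis using P_split[of h] P_tail[of h] dual_ballD(4)[OF g(1), of 0 h] by linarith
  qed
  have Px: "P x > 0"
  proof -
    have "norm x - \<kappa> \<le> g 0 x" using G(2)[of x 0] g(2)[of 0] by (simp add: \<theta>_def u0)
    moreover have "\<mu> * norm x \<le> 1 / 2 * norm x" using \<mu>(2) by (intro mult_right_mono) auto
    ultimately have "P x \<ge> 1 / 2 * norm x - \<kappa>" using P_split[of x] P_tail[of x] by linarith
    then show ?thesis using r(2)[OF xC] r(1) \<kappa>(2) by linarith
  qed
  define f where "f h = - P h / 2" for h
  have f: "f \<in> dual_ball"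
    unfolding dual_ball_def
  proof (intro CollectI conjI allI)
    show "linear f"
      by (rule linearI) (simp_all add: f_def linear_add[OF linP] linear_scale[OF linP] field_simps)
    show "f h \<le> norm h" for h using P_le[of h] by (simp add: f_def)
  qed
  define v where "v = (- 2 / P x) *\<^sub>R x"
  have "f v = 1" using Px unfolding f_def v_def linear_scale[OF linP] by simp
  moreover have "v \<in> Y" unfolding v_def Y_def by (rule subspace_scale[OF Q(3)]) (use xY in \<open>simp add: Y_def\<close>)
  moreover have "frechet_bound S x f"
    unfolding frechet_bound_def
  proof (intro allI impI)
    fix \<eta> :: real assume \<eta>: "\<eta> > 0"
    obtain \<delta> where \<delta>: "\<delta> > 0" "\<forall>h\<in>Y. norm h < \<delta> \<longrightarrow>
        (\<Sum>n. w n * G n (x + h - u n)) \<le> (\<Sum>n. w n * G n (x - u n)) + (\<Sum>n. w n * g n h) + \<eta> * norm h"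
    proof -
      have "\<exists>\<delta>>0. \<forall>h\<in>Y. norm h < \<delta> \<longrightarrow>
        (\<Sum>n. w n * G n (x + h - u n)) \<le> (\<Sum>n. w n * G n (x - u n)) + (\<Sum>n. w n * g n h) + \<eta> * norm h"
      proof (rule upper_gradient_suminf[where \<phi> = "\<lambda>n z. G n (z - u n)"])
        show "G n (y - u n) - G n (z - u n) \<le> norm (y - z)" for n y z
          using G(3)[of n "y - u n" "z - u n"] by simp
        show "\<exists>\<delta>>0. \<forall>h\<in>Y. norm h < \<delta> \<longrightarrow> G n (x + h - u n) \<le> G n (x - u n) + g n h + \<eta> * norm h"
          if "\<eta> > 0" for n \<eta>
          using ug[OF that, of n] by (simp add: algebra_simps)
      qed (use w sw sm g \<eta> in \<open>auto intro: less_imp_le\<close>)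
      then show ?thesis using that by blast
    qed
    show "\<exists>\<delta>>0. \<forall>c\<in>S. norm (c - x) < \<delta> \<longrightarrow> f (c - x) \<le> \<eta> * norm (c - x)"
    proof (intro exI[of _ \<delta>] conjI ballI impI)
      fix c assume c: "c \<in> S" "norm (c - x) < \<delta>"
      have "c - x \<in> Y" unfolding Y_def
        by (rule subspace_diff[OF Q(3)]) (use c xY S(4) in \<open>auto simp: Y_def\<close>)
      then have "(\<Sum>n. w n * G n (c - u n)) \<le> (\<Sum>n. w n * G n (x - u n)) + P (c - x) + \<eta> * norm (c - x)"
        using \<delta>(2) c(2) by (force simp: P_def)
      then have "- P (c - x) \<le> \<eta> * norm (c - x)" using min[OF c(1)] by linarith
      moreover have "0 \<le> \<eta> * norm (c - x)" using \<eta> by simp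
      ultimately show "f (c - x) \<le> \<eta> * norm (c - x)" unfolding f_def by linarith
    qed (rule \<delta>(1))
  qed
  ultimately have "\<exists>p\<in>dual_ball. 1 \<le> p v \<and> frechet_bound C x p"
    using reduction[OF xC _ _ f, of v] xY by (simp add: Y_def S_def)
  then obtain p where "p \<in> dual_ball" "1 \<le> p v" "frechet_bound C x p" by blast
  then show thesis by (rule that[OF xC near])
qed

theorem corollary2:
  fixes A B :: "'a::banach set" and \<epsilon> :: real
  assumes "asplund_space TYPE('a)"
    and "A \<noteq> {}" and "B \<noteq> {}"
    and "closed (diff_set A B)"
    and "A \<inter> B = {}"
    and "\<epsilon> > 0"
  shows "\<exists>a\<in>A. \<exists>b\<in>B. norm (a - b) < setdist A B + \<epsilon> \<and>
           (\<exists>a' :: 'a \<Rightarrow>\<^sub>L real. norm a' = 1 \<and>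
              a' \<in> frechet_normal_cone A a \<and> - a' \<in> frechet_normal_cone B b)"
proof -
  have "setdist A B < setdist A B + \<epsilon> / 2" using \<open>\<epsilon> > 0\<close> by simp
  then obtain a0 b0 where ab0: "a0 \<in> A" "b0 \<in> B" "dist a0 b0 < setdist A B + \<epsilon> / 2"
    by (rule setdist_ltE[OF _ assms(2,3)])
  have C: "a - b \<in> diff_set A B" if "a \<in> A" "b \<in> B" for a b
    using that by (auto simp: diff_set_def)
  have "0 \<notin> diff_set A B" using \<open>A \<inter> B = {}\<close> by (auto simp: diff_set_def)
  then obtain x p v where x: "x \<in> diff_set A B" "norm x < norm (a0 - b0) + \<epsilon> / 2"
    and p: "p \<in> dual_ball" "1 \<le> p v" "frechet_bound (diff_set A B) x p"
    using closed_set_frechet_normal[OF assms(1,4) _ C[OF ab0(1,2)], of "\<epsilon> / 2"] \<open>\<epsilon> > 0\<close> by auto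
  obtain a b where ab: "a \<in> A" "b \<in> B" "x = a - b" using x(1) by (auto simp: diff_set_def)
  note lin = dual_ballD(1)[OF p(1)]
  have "bounded_linear p"
    by (rule bounded_linear_intro[of p 1])
      (use dual_ballD(4)[OF p(1)] in \<open>auto simp: linear_add[OF lin] linear_scale[OF lin]\<close>)
  then have app: "blinfun_apply (Blinfun p) = p" by (rule bounded_linear_Blinfun_apply)
  define N where "N = norm (Blinfun p)"
  have "Blinfun p \<noteq> 0"
  proof
    assume "Blinfun p = 0"
    then have "p v = 0" using app by (metis blinfun.zero_left)
    then show False using p(2) by simp
  qed
  then have N: "N > 0" by (simp add: N_def)
  define a' where "a' = (1 / N) *\<^sub>R Blinfun p"
  have a'_app: "blinfun_apply a' h = p h / N" for h
    by (simp add: a'_def scaleR_blinfun.rep_eq app)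
  have bound: "\<exists>\<delta>>0. \<forall>c\<in>diff_set A B. norm (c - (a - b)) < \<delta> \<longrightarrow>
      p (c - (a - b)) / N \<le> \<eta> * norm (c - (a - b))" if "\<eta> > 0" for \<eta>
  proof -
    have "\<eta> * N > 0" using that N by simp
    with p(3) obtain \<delta> where "\<delta> > 0" "\<forall>c\<in>diff_set A B. norm (c - x) < \<delta> \<longrightarrow> p (c - x) \<le> \<eta> * N * norm (c - x)"
      unfolding frechet_bound_def by blast
    then show ?thesis using N unfolding ab(3) by (intro exI[of _ \<delta>]) (auto simp: field_simps)
  qed
  have "a' \<in> frechet_normal_cone A a"
    unfolding frechet_normal_cone_iff a'_app
  proof (intro allI impI)
    fix \<eta> :: real assume "\<eta> > 0"
    from bound[OF this] obtain \<delta> where \<delta>: "\<delta> > 0" "\<forall>c\<in>diff_set A B. norm (c - (a - b)) < \<delta> \<longrightarrow>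
      p (c - (a - b)) / N \<le> \<eta> * norm (c - (a - b))" by blast
    show "\<exists>\<delta>>0. \<forall>z\<in>A. norm (z - a) < \<delta> \<longrightarrow> p (z - a) / N \<le> \<eta> * norm (z - a)"
      using \<delta>(1) bspec[OF \<delta>(2) C[OF _ ab(2)]] by (intro exI[of _ \<delta>]) auto
  qed
  moreover have "- a' \<in> frechet_normal_cone B b"
    unfolding frechet_normal_cone_iff
  proof (intro allI impI)
    fix \<eta> :: real assume "\<eta> > 0"
    from bound[OF this] obtain \<delta> where \<delta>: "\<delta> > 0" "\<forall>c\<in>diff_set A B. norm (c - (a - b)) < \<delta> \<longrightarrow>
      p (c - (a - b)) / N \<le> \<eta> * norm (c - (a - b))" by blast
    show "\<exists>\<delta>>0. \<forall>z\<in>B. norm (z - b) < \<delta> \<longrightarrow> blinfun_apply (- a') (z - b) \<le> \<eta> * norm (z - b)"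
    proof (intro exI[of _ \<delta>] conjI ballI impI)
      fix z assume z: "z \<in> B" "norm (z - b) < \<delta>"
      have e: "a - z - (a - b) = - (z - b)" by simp
      have "p (- (z - b)) / N \<le> \<eta> * norm (- (z - b))"
        using bspec[OF \<delta>(2) C[OF ab(1) z(1)]] z(2) unfolding e norm_minus_cancel by blast
      then show "blinfun_apply (- a') (z - b) \<le> \<eta> * norm (z - b)"
        unfolding norm_minus_cancel by (simp add: blinfun.minus_left a'_app linear_neg[OF lin] del: minus_diff_eq)
    qed (rule \<delta>(1))
  qed
  moreover have "norm a' = 1" using N by (simp add: a'_def N_def)
  moreover have "norm (a - b) < setdist A B + \<epsilon>"
    using x(2) ab0(3) unfolding ab(3) dist_norm by linarith
  ultimately show ?thesis using ab(1,2) by blast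
qed

end
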